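(* Let $\mathbb{F}$ be an algebraically closed field, and let $m,r\ge1$, $0\le p\le N-2$ be integers. Let $\sigma_0,\ldots,\sigma_{N-1}\in\mathbb{F}$, let $\xi_1,\ldots,\xi_N\in(\mathbb{F}\cup\{\infty\})\setminus\{0\}$, and let $\beta_0,\ldots,\beta_N\in\mathbb{F}$ be nonzero. Put $$g_i=\beta_i(1-\lambda/\xi_i),\quad h_j=\lambda-\sigma_j,\quad b_0(\lambda)=\frac1{\beta_0},\quad b_i(\lambda)=\frac1{\beta_0}\prod_{k=1}^{i}\frac{h_{k-1}}{g_k},$$ for $i=1,\ldots,N$ and $j=0,\ldots,N-1$. Let $\widetilde D_0,\ldots,\widetilde D_p\in\mathbb{F}^{m\times m}$, $\widetilde L_{p+1},\ldots,\widetilde L_N\in\mathbb{F}^{m\times r}$, $\widetilde U\in\mathbb{F}^{m\times r}$, and let $$\widetilde Q_N(\lambda)=\sum_{i=0}^{p}b_i(\lambda)\widetilde D_i+\sum_{i=p+1}^{N}b_i(\lambda)\widetilde L_i\widetilde U^T\in\mathbb{F}(\lambda)^{m\times m},\qquad \widetilde L_N(\lambda)=\begin{bmatrix} \widetilde M_N(\lambda) \\ \widetilde K_N(\lambda) \end{bmatrix},$$ where $$\widetilde M_N(\lambda)=\begin{bmatrix}\frac{g_N}{\beta_N}\widetilde D_0&\frac{g_N}{\beta_N}\widetilde D_1&\cdots&\frac{g_N}{\beta_N}\widetilde D_p&\frac{g_N}{\beta_N}\widetilde L_{p+1}&\cdots&\frac{g_N}{\beta_N}\widetilde L_{N-2}&\frac{g_N}{\beta_N}\widetilde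 L_{N-1}+\frac{h_{N-1}}{\beta_N}\widetilde L_N\end{bmatrix},$$ $$\widetilde K_N(\lambda)=\begin{bmatrix}-h_0I_m&g_1I_m \\ &\ddots&\ddots \\ &&-h_{p-1}I_m&g_pI_m \\ &&&-h_p\widetilde U^T&g_{p+1}I_r \\ &&&&-h_{p+1}I_r&g_{p+2}I_r \\ &&&&&\ddots&\ddots \\ &&&&&&-h_{N-2}I_r&g_{N-1}I_r\end{bmatrix}.$$ Let $\mathcal{P}_N$ and $i_N$ be, respectively, the set of finite poles and the number of infinite poles in the list $(\xi_1,\ldots,\xi_N)$. Then: (a) $\widetilde L_N(\lambda)$, partitioned into the block rows $\widetilde M_N(\lambda)$ (in the role of $M(\lambda)$) and $\widetilde K_N(\lambda)$ (in the role of $K(\lambda)$), is a block full rank pencil with only one block column associated with $\widetilde Q_N(\lambda)$ in $\mathbb{F}\setminus\mathcal{P}_N$. (b) $\widetilde L_N(\lambda)$ is a linearization with empty state matrix of $\widetilde Q_N(\lambda)$ in $\mathbb{F}\setminus\mathcal{P}_N$. (c) If, in addition, the poles $\xi_{p+1},\xi_{p+2},\ldots,\xi_{N-1}$ are all finite, then $\widetilde L_N(\lambda)$ is a linearization with empty state matrix of $\widetilde Q_N(\lambda)$ at $\infty$ of grade $i_N$.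
   Context: Conventions: $\lambda/\xi_i:=0$ if $\xi_i=\infty$. The elements $\xi_i$ are called poles; $\mathcal{P}_N=\{\xi_i:\xi_i\ne\infty\}$ and $i_N=\#\{i:\xi_i=\infty\}$ (counted with repetition). The poles are not assumed distinct from the nodes $\sigma_j$. (The pencil $\widetilde L_N(\lambda)$ should not be confused with the constant matrix $\widetilde L_N$.) For a rational matrix $R(\lambda)$ and an integer $g$, $\operatorname{rev}_gR(\lambda):=\lambda^gR(1/\lambda)$. A pencil is a polynomial matrix of degree at most $1$. A rational matrix $R(\lambda)$ with $k$ rows has full row rank in $\Omega\subseteq\mathbb{F}$ if, for all $\lambda_0\in\Omega$, no entry of $R$ has a pole at $\lambda_0$ and $\operatorname{rank}R(\lambda_0)=k$. A square rational matrix is regular at $\lambda_0$ if no entry has a pole at $\lambda_0$ and its determinant is nonzero at $\lambda_0$. A block full rank pencil with only one block column is a pencil $L(\lambda)=\begin{bmatrix} M(\lambda) \\ K(\lambda) \end{bmatrix}$ with $K(\lambda)$ of full row normal rank (full row rank over $\mathbb{F}(\lambda)$). A rational basis $N(\lambda)$ dual to $K(\lambda)\in\mathbb{F}(\lambda)^{a\times k}$ is a rational matrix of size $(k-a)\times k$ with full row normal rank and $K(\lambda)N(\lambda)^T=0$. Such a pencil $L(\lambda)$ is said to be associated with a rational matrix $G(\lambda)$ in $\Omega\subseteq\mathbb{F}$ if there is a rational basis $N(\lambda)$ dual to $K(\lambda)$ and a square rational matrix $N_2(\lambda)$ regular at every point of $\Omega$ (for instance the identity) such that $K(\lambda)$ and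 $N(\lambda)$ have full row rank in $\Omega$ and $G(\lambda)=N_2(\lambda)M(\lambda)N(\lambda)^T$. A pencil $L(\lambda)\in\mathbb{F}[\lambda]^{q\times t}$ is a linearization with empty state matrix of $G(\lambda)\in\mathbb{F}(\lambda)^{m\times m}$ in $\Omega\subseteq\mathbb{F}$ if for each $\lambda_0\in\Omega$ there exist integers $s_1,s_2\ge0$ with $s_1-s_2=q-m=t-m$ and rational matrices $R_1,R_2$ regular at $\lambda_0$, both of size $m+s_1$, such that $R_1\,\mathrm{diag}(G,I_{s_1})\,R_2=\mathrm{diag}(L,I_{s_2})$. It is a linearization with empty state matrix of $G(\lambda)$ at $\infty$ of grade $g$ if there exist integers $s_1,s_2\ge0$ with $s_1-s_2=q-m=t-m$ and rational matrices $Q_1,Q_2$ regular at $0$, both of size $m+s_1$, such that $Q_1\,\mathrm{diag}(\operatorname{rev}_gG,I_{s_1})\,Q_2=\mathrm{diag}(\operatorname{rev}_\ell L,I_{s_2})$, where $\ell=\deg L(\lambda)$. *)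

theory Defs
  imports
    "HOL-Computational_Algebra.Polynomial_Factorial"
    "Jordan_Normal_Form.DL_Rank"
begin

section \<open>Rational functions\<close>

text \<open>
  Elements of \<open>'a poly fract\<close> are formal fractions. Evaluation at a point and the substitution
  of \<open>1/\<lambda>\<close> for \<open>\<lambda>\<close> are defined through representatives; the lemmas below show that the value does
  not depend on the representative. Outside its domain, \<open>rat_eval\<close> has no meaning.
\<close>

definition rat_const :: "'a :: field \<Rightarrow> 'a poly fract" where
  "rat_const c = to_fract [:c:]"

definition rat_X :: "'a :: field poly fract" where
  "rat_X = to_fract [:0, 1:]"

definition no_pole_at :: "'a :: field \<Rightarrow> 'a poly fract \<Rightarrow> bool" where
  "no_pole_at x f \<longleftrightarrow> (\<exists>a b. f = Fract a b \<and> poly b x \<noteq> 0)"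

definition rat_eval :: "'a :: field \<Rightarrow> 'a poly fract \<Rightarrow> 'a" where
  "rat_eval x f = (THE y. \<exists>a b. f = Fract a b \<and> poly b x \<noteq> 0 \<and> y = poly a x / poly b x)"

lemma rat_eval_Fract:
  assumes "poly b x \<noteq> 0"
  shows "rat_eval x (Fract a b) = poly a x / poly b x"
  unfolding rat_eval_def
proof (rule the_equality)
  show "\<exists>a' b'. Fract a b = Fract a' b' \<and> poly b' x \<noteq> 0 \<and> poly a x / poly b x = poly a' x / poly b' x"
    using assms by blast
next
  fix y assume "\<exists>a' b'. Fract a b = Fract a' b' \<and> poly b' x \<noteq> 0 \<and> y = poly a' x / poly b' x"
  then obtain a' b' where *: "Fract a b = Fract a' b'" "poly b' x \<noteq> 0" "y = poly a' x / poly b' x"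
    by blast
  have "b \<noteq> 0" "b' \<noteq> 0"
    using assms * by auto
  with * have "a * b' = a' * b"
    by (simp add: eq_fract)
  hence "poly a x * poly b' x = poly a' x * poly b x"
    by (metis poly_mult)
  with assms * show "y = poly a x / poly b x"
    by (simp add: frac_eq_eq)
qed

definition poly_recip :: "'a :: field poly \<Rightarrow> 'a poly fract" where
  "poly_recip p = poly (map_poly rat_const p) (1 / rat_X)"

definition rat_recip :: "'a :: field poly fract \<Rightarrow> 'a poly fract" where
  "rat_recip f = (THE h. \<exists>a b. b \<noteq> 0 \<and> f = Fract a b \<and> h = poly_recip a / poly_recip b)"

lemma rat_const_simps [simp]:
  "rat_const 0 = 0" "rat_const 1 = 1"
  "rat_const (c + d) = rat_const c + rat_const d"
  "rat_const (c * d) = rat_const c * rat_const d"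
  by (simp_all add: rat_const_def flip: to_fract_add to_fract_mult one_pCons)

lemma rat_X_nonzero [simp]: "rat_X \<noteq> (0 :: 'a :: field poly fract)"
  by (simp add: rat_X_def)

lemma poly_recip_0 [simp]: "poly_recip 0 = 0"
  by (simp add: poly_recip_def)

lemma poly_recip_pCons [simp]: "poly_recip (pCons c p) = rat_const c + poly_recip p / rat_X"
  by (simp add: poly_recip_def map_poly_pCons)

lemma poly_recip_add: "poly_recip (p + q) = poly_recip p + poly_recip q"
  by (induction p q rule: poly_induct2) (simp_all add: add_divide_distrib)

lemma poly_recip_smult: "poly_recip (Polynomial.smult c q) = rat_const c * poly_recip q"
  by (induction q) (simp_all add: algebra_simps)

lemma poly_recip_mult: "poly_recip (p * q) = poly_recip p * poly_recip q"
  by (induction p) (simp_all add: poly_recip_add poly_recip_smult algebra_simps)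

lemma poly_recip_eq_0_iff [simp]: "poly_recip p = 0 \<longleftrightarrow> p = 0"
proof -
  have Xn: "rat_X ^ n = to_fract ([:0, 1:] ^ n :: 'a poly)" for n
    by (induction n) (simp_all only: power_0 power_Suc to_fract_1 to_fract_mult rat_X_def)
  have "\<exists>h. rat_X ^ degree p * poly_recip p = to_fract h \<and> coeff h 0 = lead_coeff p"
  proof (induction p)
    case 0
    then show ?case by (auto intro!: exI[of _ 0])
  next
    case (pCons c p)
    show ?case
    proof (cases "p = 0")
      case True
      then show ?thesis by (auto intro!: exI[of _ "[:c:]"] simp: rat_const_def)
    next
      case False
      from pCons obtain h where h: "rat_X ^ degree p * poly_recip p = to_fract h"
        "coeff h 0 = lead_coeff p" by blast
      have "rat_X ^ degree (pCons c p) * poly_recip (pCons c p) =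
          rat_X ^ Suc (degree p) * rat_const c + rat_X ^ degree p * poly_recip p"
        using False by (simp add: field_simps)
      also have "\<dots> = rat_X * rat_X ^ degree p * rat_const c + to_fract h"
        by (simp only: h) simp
      also have "rat_X ^ degree p = to_fract ([:0, 1:] ^ degree p :: 'a poly)"
        by (rule Xn)
      also have "rat_X * to_fract ([:0, 1:] ^ degree p) * rat_const c + to_fract h =
          to_fract ([:0, 1:] * [:0, 1:] ^ degree p * [:c:] + h)"
        by (simp only: rat_X_def rat_const_def to_fract_add to_fract_mult)
      finally show ?thesis
        using False h(2) by (intro exI[of _ "[:0, 1:] * [:0, 1:] ^ degree p * [:c:] + h"]) simp
    qed
  qed
  thus ?thesis
    by (metis coeff_0 leading_coeff_0_iff mult_zero_right poly_recip_0 to_fract_eq_0_iff)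
qed

lemma rat_recip_Fract:
  assumes "b \<noteq> 0"
  shows "rat_recip (Fract a b) = poly_recip a / poly_recip b"
  unfolding rat_recip_def
proof (rule the_equality)
  show "\<exists>a' b'. b' \<noteq> 0 \<and> Fract a b = Fract a' b' \<and> poly_recip a / poly_recip b = poly_recip a' / poly_recip b'"
    using assms by blast
next
  fix h assume "\<exists>a' b'. b' \<noteq> 0 \<and> Fract a b = Fract a' b' \<and> h = poly_recip a' / poly_recip b'"
  then obtain a' b' where *: "b' \<noteq> 0" "Fract a b = Fract a' b'" "h = poly_recip a' / poly_recip b'"
    by blast
  with assms have "a * b' = a' * b"
    by (simp add: eq_fract)
  hence "poly_recip a * poly_recip b' = poly_recip a' * poly_recip b"
    by (metis poly_recip_mult)
  with assms * show "h = poly_recip a / poly_recip b"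
    by (simp add: frac_eq_eq)
qed


section \<open>Rational matrices and pencils\<close>

definition rat_mat :: "'a :: field poly mat \<Rightarrow> 'a poly fract mat" where
  "rat_mat A = map_mat to_fract A"

definition no_pole_mat_at :: "'a :: field \<Rightarrow> 'a poly fract mat \<Rightarrow> bool" where
  "no_pole_mat_at x R \<longleftrightarrow> (\<forall>f \<in> elements_mat R. no_pole_at x f)"

definition full_row_rank :: "'b :: field mat \<Rightarrow> bool" where
  "full_row_rank A \<longleftrightarrow> vec_space.rank (dim_row A) A = dim_row A"

definition full_row_rank_in :: "'a :: field poly fract mat \<Rightarrow> 'a set \<Rightarrow> bool" where
  "full_row_rank_in R \<Omega> \<longleftrightarrow>
     (\<forall>x\<in>\<Omega>. no_pole_mat_at x R \<and> full_row_rank (map_mat (rat_eval x) R))"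

definition regular_at :: "'a :: field \<Rightarrow> 'a poly fract mat \<Rightarrow> bool" where
  "regular_at x R \<longleftrightarrow> square_mat R \<and> no_pole_mat_at x R \<and> rat_eval x (det R) \<noteq> 0"

definition rev_mat :: "int \<Rightarrow> 'a :: field poly fract mat \<Rightarrow> 'a poly fract mat" where
  "rev_mat g R = map_mat (\<lambda>f. rat_X powi g * rat_recip f) R"

text \<open>The zero matrix (and the empty one) gets degree \<open>0\<close>.\<close>

definition degree_mat :: "'a :: field poly mat \<Rightarrow> nat" where
  "degree_mat L = Max (insert 0 (degree ` elements_mat L))"

definition pencil :: "'a :: field poly mat \<Rightarrow> bool" where
  "pencil L \<longleftrightarrow> degree_mat L \<le> 1"


section \<open>Block full rank pencils with only one block column\<close>

definition dual_rational_basis :: "'a :: field poly mat \<Rightarrow> 'a poly fract mat \<Rightarrow> bool" where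
  "dual_rational_basis K N \<longleftrightarrow>
     dim_row N + dim_row K = dim_col K \<and> dim_col N = dim_col K \<and>
     full_row_rank N \<and>
     rat_mat K * transpose_mat N = 0\<^sub>m (dim_row K) (dim_row N)"

definition block_full_rank_pencil ::
    "'a :: field poly mat \<Rightarrow> 'a poly mat \<Rightarrow> 'a poly mat \<Rightarrow> bool" where
  "block_full_rank_pencil L M K \<longleftrightarrow>
     pencil L \<and> dim_col M = dim_col K \<and> L = M @\<^sub>r K \<and> full_row_rank (rat_mat K)"

definition associated_in ::
    "'a :: field poly mat \<Rightarrow> 'a poly mat \<Rightarrow> 'a poly fract mat \<Rightarrow> 'a set \<Rightarrow> bool" where
  "associated_in M K G \<Omega> \<longleftrightarrow>
     (\<exists>N N\<^sub>2. dual_rational_basis K N \<and>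
        N\<^sub>2 \<in> carrier_mat (dim_row M) (dim_row M) \<and> (\<forall>x\<in>\<Omega>. regular_at x N\<^sub>2) \<and>
        full_row_rank_in (rat_mat K) \<Omega> \<and> full_row_rank_in N \<Omega> \<and>
        G = N\<^sub>2 * rat_mat M * transpose_mat N)"


section \<open>Linearizations with empty state matrix\<close>

definition linearization_in ::
    "'a :: field poly mat \<Rightarrow> 'a poly fract mat \<Rightarrow> 'a set \<Rightarrow> bool" where
  "linearization_in L G \<Omega> \<longleftrightarrow> pencil L \<and> square_mat G \<and>
     (let q = dim_row L; t = dim_col L; m = dim_row G in
      \<forall>x\<in>\<Omega>. \<exists>(s\<^sub>1::nat) (s\<^sub>2::nat) R\<^sub>1 R\<^sub>2.
        int s\<^sub>1 - int s\<^sub>2 = int q - int m \<and> int s\<^sub>1 - int s\<^sub>2 = int t - int m \<and>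
        R\<^sub>1 \<in> carrier_mat (m + s\<^sub>1) (m + s\<^sub>1) \<and> R\<^sub>2 \<in> carrier_mat (m + s\<^sub>1) (m + s\<^sub>1) \<and>
        regular_at x R\<^sub>1 \<and> regular_at x R\<^sub>2 \<and>
        R\<^sub>1 * diag_block_mat [G, 1\<^sub>m s\<^sub>1] * R\<^sub>2 = diag_block_mat [rat_mat L, 1\<^sub>m s\<^sub>2])"

definition linearization_at_infinity ::
    "'a :: field poly mat \<Rightarrow> 'a poly fract mat \<Rightarrow> int \<Rightarrow> bool" where
  "linearization_at_infinity L G g \<longleftrightarrow> pencil L \<and> square_mat G \<and>
     (let q = dim_row L; t = dim_col L; m = dim_row G; l = int (degree_mat L) in
      \<exists>(s\<^sub>1::nat) (s\<^sub>2::nat) Q\<^sub>1 Q\<^sub>2.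
        int s\<^sub>1 - int s\<^sub>2 = int q - int m \<and> int s\<^sub>1 - int s\<^sub>2 = int t - int m \<and>
        Q\<^sub>1 \<in> carrier_mat (m + s\<^sub>1) (m + s\<^sub>1) \<and> Q\<^sub>2 \<in> carrier_mat (m + s\<^sub>1) (m + s\<^sub>1) \<and>
        regular_at 0 Q\<^sub>1 \<and> regular_at 0 Q\<^sub>2 \<and>
        Q\<^sub>1 * diag_block_mat [rev_mat g G, 1\<^sub>m s\<^sub>1] * Q\<^sub>2 =
          diag_block_mat [rev_mat l (rat_mat L), 1\<^sub>m s\<^sub>2])"


section \<open>Low rank rational matrices in rational Newton form\<close>

text \<open>A pole in \<open>\<F> \<union> {\<infinity>}\<close> is an element of \<open>'a option\<close>, with \<open>None\<close> standing for \<open>\<infinity>\<close>.\<close>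

definition inverse_pole :: "'a :: field option \<Rightarrow> 'a" where
  "inverse_pole \<xi> = (case \<xi> of None \<Rightarrow> 0 | Some x \<Rightarrow> 1 / x)"

definition finite_poles :: "(nat \<Rightarrow> 'a option) \<Rightarrow> nat \<Rightarrow> 'a set" where
  "finite_poles \<xi> N = {x. \<exists>i\<in>{1..N}. \<xi> i = Some x}"

definition num_infinite_poles :: "(nat \<Rightarrow> 'a option) \<Rightarrow> nat \<Rightarrow> nat" where
  "num_infinite_poles \<xi> N = card {i\<in>{1..N}. \<xi> i = None}"

definition newton_g :: "(nat \<Rightarrow> 'a :: field) \<Rightarrow> (nat \<Rightarrow> 'a option) \<Rightarrow> nat \<Rightarrow> 'a poly" where
  "newton_g \<beta> \<xi> i = Polynomial.smult (\<beta> i) [:1, - inverse_pole (\<xi> i):]"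

definition newton_h :: "(nat \<Rightarrow> 'a :: field) \<Rightarrow> nat \<Rightarrow> 'a poly" where
  "newton_h \<sigma> j = [:- \<sigma> j, 1:]"

definition newton_b ::
    "(nat \<Rightarrow> 'a :: field) \<Rightarrow> (nat \<Rightarrow> 'a option) \<Rightarrow> (nat \<Rightarrow> 'a) \<Rightarrow> nat \<Rightarrow> 'a poly fract" where
  "newton_b \<beta> \<xi> \<sigma> i = rat_const (1 / \<beta> 0) *
     (\<Prod>k = 1..i. to_fract (newton_h \<sigma> (k - 1)) / to_fract (newton_g \<beta> \<xi> k))"

text \<open>
  \<open>D i\<close> and \<open>E i\<close> are the coefficients called $\widetilde D_i$ and $\widetilde L_i$ in the
  expansion $\sum_{i \le p} b_i \widetilde D_i + \sum_{i > p} b_i \widetilde L_i \widetilde U^T$.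
\<close>

definition newton_Q ::
    "(nat \<Rightarrow> 'a :: field) \<Rightarrow> (nat \<Rightarrow> 'a option) \<Rightarrow> (nat \<Rightarrow> 'a) \<Rightarrow> nat \<Rightarrow> nat \<Rightarrow> nat \<Rightarrow>
     (nat \<Rightarrow> 'a mat) \<Rightarrow> (nat \<Rightarrow> 'a mat) \<Rightarrow> 'a mat \<Rightarrow> 'a poly fract mat" where
  "newton_Q \<beta> \<xi> \<sigma> m p N D E U = mat m m (\<lambda>(u, v).
     (\<Sum>i = 0..p. newton_b \<beta> \<xi> \<sigma> i * rat_const (D i $$ (u, v))) +
     (\<Sum>i = p+1..N. newton_b \<beta> \<xi> \<sigma> i * rat_const ((E i * transpose_mat U) $$ (u, v))))"

definition const_mat :: "'a :: field mat \<Rightarrow> 'a poly mat" where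
  "const_mat A = map_mat (\<lambda>c. [:c:]) A"

definition append_cols :: "'b :: zero mat \<Rightarrow> 'b mat \<Rightarrow> 'b mat" where
  "append_cols A B = four_block_mat A B (0\<^sub>m 0 (dim_col A)) (0\<^sub>m 0 (dim_col B))"

text \<open>
  The block matrix with block rows \<open>i < n\<close> of heights \<open>ht i\<close>, block columns \<open>j < k\<close> of widths
  \<open>wd j\<close>, and blocks \<open>B i j\<close>, each of size \<open>ht i \<times> wd j\<close>.
\<close>

definition block_row :: "nat \<Rightarrow> nat \<Rightarrow> (nat \<Rightarrow> 'b :: zero mat) \<Rightarrow> 'b mat" where
  "block_row h k B = foldr append_cols (map B [0..<k]) (0\<^sub>m h 0)"

definition block_matrix ::
    "(nat \<Rightarrow> nat) \<Rightarrow> nat \<Rightarrow> (nat \<Rightarrow> nat) \<Rightarrow> nat \<Rightarrow> (nat \<Rightarrow> nat \<Rightarrow> 'b :: zero mat) \<Rightarrow> 'b mat" where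
  "block_matrix ht n wd k B =
     foldr append_rows (map (\<lambda>i. block_row (ht i) k (B i)) [0..<n]) (0\<^sub>m 0 (\<Sum>j<k. wd j))"

definition newton_M ::
    "(nat \<Rightarrow> 'a :: field) \<Rightarrow> (nat \<Rightarrow> 'a option) \<Rightarrow> (nat \<Rightarrow> 'a) \<Rightarrow> nat \<Rightarrow> nat \<Rightarrow> nat \<Rightarrow>
     (nat \<Rightarrow> 'a mat) \<Rightarrow> (nat \<Rightarrow> 'a mat) \<Rightarrow> 'a poly mat" where
  "newton_M \<beta> \<xi> \<sigma> m p N D E = block_row m N (\<lambda>j.
     let gN = Polynomial.smult (1 / \<beta> N) (newton_g \<beta> \<xi> N);
         hN = Polynomial.smult (1 / \<beta> N) (newton_h \<sigma> (N - 1))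
     in if j \<le> p then gN \<cdot>\<^sub>m const_mat (D j)
        else if j < N - 1 then gN \<cdot>\<^sub>m const_mat (E j)
        else gN \<cdot>\<^sub>m const_mat (E (N - 1)) + hN \<cdot>\<^sub>m const_mat (E N))"

text \<open>
  Block rows \<open>i = 0, \<dots>, N - 2\<close> and block columns \<open>j = 0, \<dots>, N - 1\<close>. Block row \<open>i\<close> has
  \<open>-h\<^sub>i\<close> in block column \<open>i\<close> and \<open>g\<^sub>i\<^sub>+\<^sub>1\<close> in block column \<open>i + 1\<close>; the identities are \<open>I\<^sub>m\<close> in block
  rows \<open>i < p\<close> and \<open>I\<^sub>r\<close> from block row \<open>p\<close> on, where the diagonal one is replaced by \<open>U\<^sup>T\<close>.
\<close>

definition newton_K ::
    "(nat \<Rightarrow> 'a :: field) \<Rightarrow> (nat \<Rightarrow> 'a option) \<Rightarrow> (nat \<Rightarrow> 'a) \<Rightarrow> nat \<Rightarrow> nat \<Rightarrow> nat \<Rightarrow> nat \<Rightarrow>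
     'a mat \<Rightarrow> 'a poly mat" where
  "newton_K \<beta> \<xi> \<sigma> m r p N U =
     (let ht = (\<lambda>i. if i < p then m else r); wd = (\<lambda>j. if j \<le> p then m else r)
      in block_matrix ht (N - 1) wd N (\<lambda>i j.
           if j = i then
             (- newton_h \<sigma> i) \<cdot>\<^sub>m (if i = p then const_mat (transpose_mat U) else 1\<^sub>m (ht i))
           else if j = i + 1 then newton_g \<beta> \<xi> (i + 1) \<cdot>\<^sub>m 1\<^sub>m (ht i)
           else 0\<^sub>m (ht i) (wd j)))"

definition newton_L ::
    "(nat \<Rightarrow> 'a :: field) \<Rightarrow> (nat \<Rightarrow> 'a option) \<Rightarrow> (nat \<Rightarrow> 'a) \<Rightarrow> nat \<Rightarrow> nat \<Rightarrow> nat \<Rightarrow> nat \<Rightarrow>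
     (nat \<Rightarrow> 'a mat) \<Rightarrow> (nat \<Rightarrow> 'a mat) \<Rightarrow> 'a mat \<Rightarrow> 'a poly mat" where
  "newton_L \<beta> \<xi> \<sigma> m r p N D E U = newton_M \<beta> \<xi> \<sigma> m p N D E @\<^sub>r newton_K \<beta> \<xi> \<sigma> m r p N U"

end

theory Submission
  imports Defs
begin

text \<open>
  Let \<open>W\<close> be the constant block row that selects block column \<open>q \<le> p\<close>. If the matrix with block rows
  \<open>W\<close> and \<open>K\<close> is regular at a point, then its inverse has the form \<open>[T, Y]\<close>, where \<open>T\<close> is the dual
  basis of \<open>K\<close> normalised by \<open>W T = I\<close>, and \<open>M T = a G\<close> with a scalar \<open>a\<close> regular at the point gives the
  factorization of \<open>[M; K]\<close> as \<open>[a I, M Y; 0, I] diag (G, I) [W; K]\<close>. At the finite points outside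
  the poles one takes \<open>q = 0\<close> and eliminates along the \<open>g\<^sub>i\<close>. At infinity one takes \<open>q = p\<close>: the
  reversed \<open>h\<^sub>i\<close> do not vanish at \<open>0\<close>, which handles the block columns to the left of \<open>p\<close>, and
  the reversed \<open>g\<^sub>i\<close> with \<open>p < i < N\<close> do not vanish at \<open>0\<close> because these poles are finite.
\<close>

section \<open>Rational functions without a pole at a point\<close>

text \<open>Each pivot has its own obstacle: a node makes some \<open>h i\<close> vanish at a finite
  point, while an infinite pole makes the reversed \<open>g i\<close> vanish at 0. Neither direction
  of elimination works everywhere, so the position of \<open>W\<close> has to vary. At infinity q =
  p is the largest admissible choice: the selected block column must have width m, and elimination
  to the left may only cross identity blocks, never \<open>transpose_mat U\<close>, which need not
  be injective. Elimination to the right of p then uses exactly the poles assumed finite in (c).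

  The scalar a is g_N / (\<beta>_N b_q), because M carries g_N / \<beta>_N and T is divided by b_q.
  For q = 0 it is a constant multiple of g_N, nonzero away from the finite poles. For q = p its
  reversal of grade 1 is a unit at 0 times one power of \<lambda> for every infinite pole among
  \<xi>_1, ..., \<xi>_p and \<xi>_N. As the poles in between are finite, the exponent is i_N; this
  is the origin of the grade. The pole \<xi>_N does not occur in K and acts only through a and
  M.\<close>

lemma to_fract_eq_Fract: "to_fract a = Fract a 1"
  by (simp add: to_fract_def)

lemma no_pole_atE:
  assumes "no_pole_at x f"
  obtains a b where "f = Fract a b" "poly b x \<noteq> 0" "rat_eval x f = poly a x / poly b x"
  using assms rat_eval_Fract unfolding no_pole_at_def by metis

lemma no_pole_at_Fract: "poly b x \<noteq> 0 \<Longrightarrow> no_pole_at x (Fract a b)"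
  unfolding no_pole_at_def by blast

lemma no_pole_at_to_fract [simp]: "no_pole_at x (to_fract a)"
  and rat_eval_to_fract [simp]: "rat_eval x (to_fract a) = poly a x"
  by (simp_all add: to_fract_eq_Fract no_pole_at_Fract rat_eval_Fract)

lemma no_pole_at_0 [simp]: "no_pole_at x 0" and rat_eval_0 [simp]: "rat_eval x 0 = 0"
  and no_pole_at_1 [simp]: "no_pole_at x 1" and rat_eval_1 [simp]: "rat_eval x 1 = 1"
  using no_pole_at_to_fract[of x 0] rat_eval_to_fract[of x 0]
    no_pole_at_to_fract[of x 1] rat_eval_to_fract[of x 1] by simp_all

lemma
  assumes "no_pole_at x f" "no_pole_at x g"
  shows no_pole_at_add: "no_pole_at x (f + g)"
    and rat_eval_add: "rat_eval x (f + g) = rat_eval x f + rat_eval x g"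
    and no_pole_at_mult: "no_pole_at x (f * g)"
    and rat_eval_mult: "rat_eval x (f * g) = rat_eval x f * rat_eval x g"
proof -
  from assms obtain a b c d where *: "f = Fract a b" "poly b x \<noteq> 0" "g = Fract c d" "poly d x \<noteq> 0"
    "rat_eval x f = poly a x / poly b x" "rat_eval x g = poly c x / poly d x"
    by (metis no_pole_atE)
  then have bd: "b \<noteq> 0" "d \<noteq> 0"
    by auto
  have p: "poly (b * d) x \<noteq> 0"
    using * by simp
  have s: "f + g = Fract (a * d + c * b) (b * d)" "f * g = Fract (a * c) (b * d)"
    using * bd by simp_all
  show "no_pole_at x (f + g)" "no_pole_at x (f * g)"
    unfolding s by (intro no_pole_at_Fract p)+
  show "rat_eval x (f + g) = rat_eval x f + rat_eval x g"
    "rat_eval x (f * g) = rat_eval x f * rat_eval x g"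
    unfolding s rat_eval_Fract[OF p] using * by (simp_all add: add_frac_eq)
qed

lemma
  assumes "\<And>i. i \<in> A \<Longrightarrow> no_pole_at x (f i)"
  shows no_pole_at_sum: "no_pole_at x (sum f A)"
    and rat_eval_sum: "rat_eval x (sum f A) = (\<Sum>i\<in>A. rat_eval x (f i))"
    and no_pole_at_prod: "no_pole_at x (prod f A)"
    and rat_eval_prod: "rat_eval x (prod f A) = (\<Prod>i\<in>A. rat_eval x (f i))"
proof -
  have "no_pole_at x (sum f A) \<and> rat_eval x (sum f A) = (\<Sum>i\<in>A. rat_eval x (f i)) \<and>
      no_pole_at x (prod f A) \<and> rat_eval x (prod f A) = (\<Prod>i\<in>A. rat_eval x (f i))"
    using assms
  proof (induction A rule: infinite_finite_induct)
    case (insert a A)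
    then show ?case
      by (simp add: no_pole_at_add rat_eval_add no_pole_at_mult rat_eval_mult)
  qed simp_all
  then show "no_pole_at x (sum f A)" "rat_eval x (sum f A) = (\<Sum>i\<in>A. rat_eval x (f i))"
    "no_pole_at x (prod f A)" "rat_eval x (prod f A) = (\<Prod>i\<in>A. rat_eval x (f i))"
    by blast+
qed

section \<open>Evaluation of rational matrices: products, determinants, inverses, rank\<close>

lemma no_pole_mat_at_iff:
  "no_pole_mat_at x A \<longleftrightarrow> (\<forall>i < dim_row A. \<forall>j < dim_col A. no_pole_at x (A $$ (i, j)))"
  unfolding no_pole_mat_at_def by (metis carrier_matI elements_matD elements_matI)

lemma
  assumes "A \<in> carrier_mat k l" "B \<in> carrier_mat l n" "no_pole_mat_at x A" "no_pole_mat_at x B"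
  shows no_pole_mat_at_mult: "no_pole_mat_at x (A * B)"
    and rat_eval_mat_mult:
      "map_mat (rat_eval x) (A * B) = map_mat (rat_eval x) A * map_mat (rat_eval x) B"
proof -
  have *: "no_pole_at x (A $$ (i, s) * B $$ (s, j))"
    if "i < k" "s < l" "j < n" for i s j
    using assms that by (auto simp: no_pole_mat_at_iff intro: no_pole_at_mult)
  have e: "(A * B) $$ (i, j) = (\<Sum>s = 0..<l. A $$ (i, s) * B $$ (s, j))" if "i < k" "j < n" for i j
    using assms(1,2) that by (auto simp: scalar_prod_def)
  show "no_pole_mat_at x (A * B)"
    using assms(1,2) by (auto simp: no_pole_mat_at_iff e simp del: index_mult_mat(1) intro!: no_pole_at_sum *)
  show "map_mat (rat_eval x) (A * B) = map_mat (rat_eval x) A * map_mat (rat_eval x) B"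
  proof (rule eq_matI)
    fix i j assume "i < dim_row (map_mat (rat_eval x) A * map_mat (rat_eval x) B)"
      "j < dim_col (map_mat (rat_eval x) A * map_mat (rat_eval x) B)"
    then have ij: "i < k" "j < n"
      using assms(1,2) by auto
    have "map_mat (rat_eval x) (A * B) $$ (i, j) = (\<Sum>s = 0..<l. rat_eval x (A $$ (i, s) * B $$ (s, j)))"
      using ij assms(1,2) e[OF ij] rat_eval_sum[of "{0..<l}" x "\<lambda>s. A $$ (i, s) * B $$ (s, j)"] *
      by (simp del: index_mult_mat(1))
    also have "\<dots> = (\<Sum>s = 0..<l. rat_eval x (A $$ (i, s)) * rat_eval x (B $$ (s, j)))"
      using assms ij by (intro sum.cong refl rat_eval_mult) (auto simp: no_pole_mat_at_iff)
    also have "\<dots> = (map_mat (rat_eval x) A * map_mat (rat_eval x) B) $$ (i, j)"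
      using assms(1,2) ij by (auto simp: scalar_prod_def)
    finally show "map_mat (rat_eval x) (A * B) $$ (i, j) =
      (map_mat (rat_eval x) A * map_mat (rat_eval x) B) $$ (i, j)" .
  qed (use assms(1,2) in auto)
qed

text \<open>Evaluation respects sums and products only among functions without a pole at x. The
  Leibniz formula reduces the determinant to sums and products of entries and signs, which all are
  such functions.\<close>

lemma
  assumes A: "A \<in> carrier_mat n n" and np: "no_pole_mat_at x A"
  shows no_pole_at_det: "no_pole_at x (det A)"
    and rat_eval_det: "rat_eval x (det A) = det (map_mat (rat_eval x) A)"
proof -
  \<comment> \<open>Signs are constant polynomials, hence free of poles and with the expected
    value.\<close>
  have sg: "(signof \<pi> :: 'a poly fract) = to_fract (signof \<pi>)" for \<pi> :: "nat \<Rightarrow> nat"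
    by (simp add: sign_def)
  have "(signof \<pi> :: 'a) = poly (signof \<pi>) x" for \<pi> :: "nat \<Rightarrow> nat"
    by (simp add: sign_def)
  then have s: "no_pole_at x (signof \<pi>)" "rat_eval x (signof \<pi>) = signof \<pi>" for \<pi> :: "nat \<Rightarrow> nat"
    unfolding sg by simp_all
  have e: "no_pole_at x (A $$ (i, \<pi> i))" if "\<pi> permutes {0..<n}" "i \<in> {0..<n}" for \<pi> i
    using np A that permutes_in_image[OF that(1)] by (auto simp: no_pole_mat_at_iff)
  have t: "no_pole_at x (signof \<pi> * (\<Prod>i = 0..<n. A $$ (i, \<pi> i)))"
    if "\<pi> permutes {0..<n}" for \<pi>
    by (intro no_pole_at_mult no_pole_at_prod s e that)
  show "no_pole_at x (det A)"
    unfolding det_def'[OF A] by (intro no_pole_at_sum t) simp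
  have "rat_eval x (det A) =
      (\<Sum>\<pi> \<in> {\<pi>. \<pi> permutes {0..<n}}. rat_eval x (signof \<pi> * (\<Prod>i = 0..<n. A $$ (i, \<pi> i))))"
    unfolding det_def'[OF A] by (intro rat_eval_sum t) simp
  also have "\<dots> = (\<Sum>\<pi> \<in> {\<pi>. \<pi> permutes {0..<n}}.
      signof \<pi> * (\<Prod>i = 0..<n. rat_eval x (A $$ (i, \<pi> i))))"
  proof (intro sum.cong refl)
    fix \<pi> assume \<pi>: "\<pi> \<in> {\<pi>. \<pi> permutes {0..<n}}"
    then have "no_pole_at x (\<Prod>i = 0..<n. A $$ (i, \<pi> i))"
      by (intro no_pole_at_prod e) auto
    moreover have "rat_eval x (\<Prod>i = 0..<n. A $$ (i, \<pi> i)) = (\<Prod>i = 0..<n. rat_eval x (A $$ (i, \<pi> i)))"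
      using \<pi> by (intro rat_eval_prod e) auto
    ultimately show "rat_eval x (signof \<pi> * (\<Prod>i = 0..<n. A $$ (i, \<pi> i))) =
        signof \<pi> * (\<Prod>i = 0..<n. rat_eval x (A $$ (i, \<pi> i)))"
      by (simp only: rat_eval_mult[OF s(1)] s(2))
  qed
  also have "\<dots> = det (map_mat (rat_eval x) A)"
    using A permutes_in_image
    by (subst det_def'[of _ n]) (auto intro!: sum.cong prod.cong)
  finally show "rat_eval x (det A) = det (map_mat (rat_eval x) A)" .
qed

lemma no_pole_at_inverse:
  assumes "no_pole_at x f" "rat_eval x f \<noteq> 0"
  shows "no_pole_at x (inverse f)" and "rat_eval x (inverse f) = inverse (rat_eval x f)"
proof -
  obtain a b where ab: "f = Fract a b" "poly b x \<noteq> 0" "rat_eval x f = poly a x / poly b x"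
    using assms(1) by (rule no_pole_atE)
  then have "poly a x \<noteq> 0"
    using assms(2) by auto
  then show "no_pole_at x (inverse f)" "rat_eval x (inverse f) = inverse (rat_eval x f)"
    using ab by (simp_all add: no_pole_at_Fract rat_eval_Fract)
qed

text \<open>Cramer's rule: the cofactors are determinants of pole-free matrices, and the only
  denominator is \<open>det A\<close>, whose value at x is nonzero.\<close>

lemma no_pole_inverse_mat:
  assumes A: "A \<in> carrier_mat n n" and np: "no_pole_mat_at x A"
    and d: "det (map_mat (rat_eval x) A) \<noteq> 0"
  obtains B where "B \<in> carrier_mat n n" "A * B = 1\<^sub>m n" "B * A = 1\<^sub>m n" "no_pole_mat_at x B"
proof -
  have ev: "rat_eval x (det A) \<noteq> 0"
    using d rat_eval_det[OF A np] by simp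
  then have d0: "det A \<noteq> 0"
    by auto
  define B where "B = inverse (det A) \<cdot>\<^sub>m adj_mat A"
  note adj = adj_mat[OF A]
  have B: "B \<in> carrier_mat n n"
    using adj by (simp add: B_def)
  have "inverse (det A) \<cdot>\<^sub>m (det A \<cdot>\<^sub>m 1\<^sub>m n) = 1\<^sub>m n"
    using d0 by (intro eq_matI) auto
  then have "A * B = 1\<^sub>m n" "B * A = 1\<^sub>m n"
    using A adj unfolding B_def
    by (simp_all add: mult_smult_distrib[OF A adj(1)] mult_smult_assoc_mat[OF adj(1) A])
  moreover have "no_pole_at x (cofactor A j i)" if "i < n" "j < n" for i j
  proof -
    have "mat_delete A j i \<in> carrier_mat (n - 1) (n - 1)"
      using A by auto
    moreover have "no_pole_mat_at x (mat_delete A j i)"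
      using np A that unfolding no_pole_mat_at_iff mat_delete_def by auto
    ultimately have "no_pole_at x (det (mat_delete A j i))"
      by (rule no_pole_at_det)
    moreover have "(- 1 :: 'a poly fract) = to_fract (- 1)"
      by simp
    then have "no_pole_at x ((- 1) ^ k)" for k
      by (induction k) (auto intro!: no_pole_at_mult simp del: to_fract_uminus)
    ultimately show ?thesis
      unfolding cofactor_def by (rule no_pole_at_mult[rotated])
  qed
  then have "no_pole_mat_at x B"
    using A unfolding no_pole_mat_at_iff B_def
    by (auto simp: adj_mat_def intro!: no_pole_at_mult no_pole_at_inverse
        no_pole_at_det[OF A np] ev)
  ultimately show thesis
    using that B by blast
qed

text \<open>Every v equals A (B v), a combination of the columns of A with coefficients B v, so the
  columns span the whole space. All rank claims below are reduced to exhibiting such a B.\<close>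

lemma full_row_rank_if_right_inverse:
  fixes A :: "'b :: field mat"
  assumes A: "A \<in> carrier_mat k n" and B: "B \<in> carrier_mat n k" and AB: "A * B = 1\<^sub>m k"
  shows "full_row_rank A"
proof -
  interpret vec_space "TYPE('b)" k .
  have cA: "set (cols A) \<subseteq> carrier_vec k"
    using A cols_dim by blast
  have "v \<in> span (set (cols A))" if v: "v \<in> carrier_vec k" for v
  proof -
    define w where "w = B *\<^sub>v v"
    have w: "w \<in> carrier_vec n" "A *\<^sub>v w = v"
      using A B AB v unfolding w_def by (auto simp flip: assoc_mult_mat_vec)
    have "lincomb_list (\<lambda>i. w $ i) (cols A) = mat_of_cols k (cols A) *\<^sub>v vec (length (cols A)) (\<lambda>i. w $ i)"
      using A by (intro lincomb_list_as_mat_mult) (auto simp: cols_def)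
    also have "mat_of_cols k (cols A) = A"
      using A by auto
    also have "vec (length (cols A)) (\<lambda>i. w $ i) = w"
      using A w by auto
    finally have "v = lincomb_list (\<lambda>i. w $ i) (cols A)"
      using w by simp
    then have "v \<in> span_list (cols A)"
      by (auto simp: span_list_def)
    then show ?thesis
      using span_list_as_span[OF cA] by simp
  qed
  then have "span (set (cols A)) = carrier_vec k"
    using span_closed[OF cA] by auto
  then have "rank A = k"
    using dim_is_n unfolding rank_def by (simp add: module_vec_def)
  then show ?thesis
    using A unfolding full_row_rank_def by simp
qed

section \<open>The substitution of 1/\<lambda> for \<lambda>\<close>

lemma rat_recip_0 [simp]: "rat_recip 0 = 0"
  and rat_recip_1 [simp]: "rat_recip 1 = 1"
proof -
  have "poly_recip 1 = 1"
    by (simp add: one_pCons)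
  then show "rat_recip 0 = 0" "rat_recip 1 = 1"
    using rat_recip_Fract[of 1 0] rat_recip_Fract[of 1 1]
    by (simp_all flip: Zero_fract_def One_fract_def)
qed

lemma rat_recip_add: "rat_recip (f + g) = rat_recip f + rat_recip g"
  by (cases f; cases g) (simp add: rat_recip_Fract poly_recip_add poly_recip_mult add_frac_eq)

lemma rat_recip_mult: "rat_recip (f * g) = rat_recip f * rat_recip g"
  by (cases f; cases g) (simp add: rat_recip_Fract poly_recip_mult)

text \<open>Unlike evaluation, this substitution is a homomorphism on the whole field, so it
  commutes with matrix products through \<open>rat_recip.mat_hom_mult\<close>.\<close>

interpretation rat_recip: semiring_hom rat_recip
  by unfold_locales (simp_all add: rat_recip_add rat_recip_mult)

lemma rat_recip_inverse: "rat_recip (inverse f) = inverse (rat_recip f)"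
proof (cases "f = 0")
  case False
  then have "rat_recip f * rat_recip (inverse f) = 1"
    by (simp flip: rat_recip_mult)
  then show ?thesis
    by (simp add: inverse_unique)
qed simp

lemma rat_recip_divide: "rat_recip (f / g) = rat_recip f / rat_recip g"
  by (simp add: divide_inverse rat_recip_mult rat_recip_inverse)

lemma rat_recip_prod: "rat_recip (prod f A) = (\<Prod>i\<in>A. rat_recip (f i))"
  by (induction A rule: infinite_finite_induct) (simp_all add: rat_recip_mult)

lemma rat_recip_to_fract: "rat_recip (to_fract a) = poly_recip a"
  using rat_recip_Fract[of 1 a] by (simp add: to_fract_eq_Fract one_pCons)

text \<open>Reversal of grade 1 swaps the two coefficients. Hence a reversed pencil is again
  polynomial, and its value at 0 is the coefficient of \<lambda>.\<close>

lemma rat_X_mult_poly_recip_linear: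
  assumes "degree a \<le> 1"
  shows "rat_X * poly_recip a = to_fract [:coeff a 1, coeff a 0:]"
proof -
  have "a = [:coeff a 0, coeff a 1:]"
    using assms by (intro poly_eqI) (auto simp: coeff_pCons coeff_eq_0 split: nat.split)
  then obtain c d where "a = [:c, d:]"
    by blast
  moreover have "rat_X * rat_const c + rat_const d = to_fract [:d, c:]"
    unfolding rat_X_def rat_const_def by (simp flip: to_fract_mult to_fract_add)
  ultimately show ?thesis
    by (simp add: distrib_left)
qed

section \<open>Stacked matrices and the factorization through a regular completion\<close>

lemma append_rows_index:
  assumes "A \<in> carrier_mat k n" "B \<in> carrier_mat l n" "i < k + l" "j < n"
  shows "(A @\<^sub>r B) $$ (i, j) = (if i < k then A $$ (i, j) else B $$ (i - k, j))"
  using assms by (simp add: append_rows_def)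

lemma append_rows_mult:
  assumes "A \<in> carrier_mat k n" "B \<in> carrier_mat l n" "C \<in> carrier_mat n s"
  shows "(A @\<^sub>r B) * C = A * C @\<^sub>r B * C"
proof -
  have row: "row (A @\<^sub>r B) i = (if i < k then row A i else row B (i - k))" if "i < k + l" for i
    using assms that by (intro eq_vecI) (auto simp: append_rows_def)
  show ?thesis
  proof (rule eq_matI)
    fix i j assume "i < dim_row (A * C @\<^sub>r B * C)" "j < dim_col (A * C @\<^sub>r B * C)"
    then have "i < k + l" "j < s"
      using assms by (simp_all add: append_rows_def)
    then show "((A @\<^sub>r B) * C) $$ (i, j) = (A * C @\<^sub>r B * C) $$ (i, j)"
      using assms row[of i] by (simp add: append_rows_def)
  qed (use assms in \<open>simp_all add: append_rows_def\<close>)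
qed

lemma map_mat_append_rows:
  assumes "A \<in> carrier_mat k n" "B \<in> carrier_mat l n"
  shows "map_mat f (A @\<^sub>r B) = map_mat f A @\<^sub>r map_mat f B"
proof (rule eq_matI)
  fix i j assume "i < dim_row (map_mat f A @\<^sub>r map_mat f B)" "j < dim_col (map_mat f A @\<^sub>r map_mat f B)"
  then have ij: "i < k + l" "j < n"
    using assms by (simp_all add: append_rows_def)
  then show "map_mat f (A @\<^sub>r B) $$ (i, j) = (map_mat f A @\<^sub>r map_mat f B) $$ (i, j)"
    using assms by (simp add: append_rows_def)
qed (use assms in \<open>simp_all add: append_rows_def\<close>)

text \<open>With R = [W; K], the identity R T = [I; 0] says that T consists of the first m columns
  of Y, and R Y = I gives K Y = [0, I]. So [M; K] Y is the block triangular matrix of the statement,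
  and multiplying by R on the right undoes Y.\<close>

lemma append_rows_factorization:
  fixes M K W :: "'b :: comm_ring_1 mat"
  assumes M: "M \<in> carrier_mat m (m + k)" and K: "K \<in> carrier_mat k (m + k)"
    and W: "W \<in> carrier_mat m (m + k)" and T: "T \<in> carrier_mat (m + k) m"
    and WT: "W * T = 1\<^sub>m m" and KT: "K * T = 0\<^sub>m k m"
    and Y: "Y \<in> carrier_mat (m + k) (m + k)"
    and RY: "(W @\<^sub>r K) * Y = 1\<^sub>m (m + k)" and YR: "Y * (W @\<^sub>r K) = 1\<^sub>m (m + k)"
  shows "M @\<^sub>r K = four_block_mat (M * T) (mat m k (\<lambda>(i, j). (M * Y) $$ (i, m + j)))
    (0\<^sub>m k m) (1\<^sub>m k) * (W @\<^sub>r K)" (is "_ = ?Z * _")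
proof -
  have R: "W @\<^sub>r K \<in> carrier_mat (m + k) (m + k)" and MK: "M @\<^sub>r K \<in> carrier_mat (m + k) (m + k)"
    using M W K by auto
  have Z: "?Z \<in> carrier_mat (m + k) (m + k)"
    using M T by auto
  have RT: "(W @\<^sub>r K) * T = 1\<^sub>m m @\<^sub>r 0\<^sub>m k m"
    unfolding append_rows_mult[OF W K T] WT KT ..
  \<comment> \<open>Apply Y on the left of \<open>RT\<close>; the factor [I; 0] picks out the first
    m columns of Y.\<close>
  have "T = Y * (1\<^sub>m m @\<^sub>r 0\<^sub>m k m)"
    using assoc_mult_mat[OF Y R T] T unfolding YR RT by simp
  moreover have "(Y * (1\<^sub>m m @\<^sub>r 0\<^sub>m k m)) $$ (i, j) = Y $$ (i, j)" if "i < m + k" "j < m" for i j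
  proof -
    have "(Y * (1\<^sub>m m @\<^sub>r 0\<^sub>m k m)) $$ (i, j) = (\<Sum>l = 0..<m + k. Y $$ (i, l) * (if l = j then 1 else 0))"
      using that Y by (auto simp: append_rows_def scalar_prod_def intro!: sum.cong)
    also have "\<dots> = Y $$ (i, j)"
      using that by (simp add: if_distrib cong: if_cong)
    finally show ?thesis .
  qed
  ultimately have TY: "T $$ (i, j) = Y $$ (i, j)" if "i < m + k" "j < m" for i j
    using that by simp
  have MTY: "(M * T) $$ (i, j) = (M * Y) $$ (i, j)" if "i < m" "j < m" for i j
    using M T Y that by (auto simp: scalar_prod_def TY)
  have RYi: "(W * Y @\<^sub>r K * Y) $$ (i, j) = (if i = j then 1 else 0)" if "i < m + k" "j < m + k" for i j
    using RY that unfolding append_rows_mult[OF W K Y] by simp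
  have KYi: "(K * Y) $$ (i, j) = (if i + m = j then 1 else 0)" if "i < k" "j < m + k" for i j
    using RYi[of "i + m" j] that K W Y by (simp add: append_rows_def)
  have "(M @\<^sub>r K) * Y = ?Z"
  proof (rule eq_matI)
    fix i j assume "i < dim_row ?Z" "j < dim_col ?Z"
    then have "i < m + k" "j < m + k"
      using Z by auto
    then show "((M @\<^sub>r K) * Y) $$ (i, j) = ?Z $$ (i, j)"
      unfolding append_rows_mult[OF M K Y] using M K Y T MTY KYi[of "i - m" j]
      by (auto simp add: append_rows_def simp del: index_mult_mat(1))
  qed (use MK Y Z in auto)
  then have "?Z * (W @\<^sub>r K) = (M @\<^sub>r K) * (Y * (W @\<^sub>r K))"
    using assoc_mult_mat[OF MK Y R] by simp
  then show ?thesis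
    using MK unfolding YR by simp
qed

lemma regular_completion:
  fixes K W :: "'a :: field poly fract mat"
  assumes K: "K \<in> carrier_mat k (m + k)" and W: "W \<in> carrier_mat m (m + k)"
    and np: "no_pole_mat_at x K" "no_pole_mat_at x W"
    and d: "det (map_mat (rat_eval x) (W @\<^sub>r K)) \<noteq> 0"
  obtains Y where "Y \<in> carrier_mat (m + k) (m + k)" "no_pole_mat_at x Y"
    "(W @\<^sub>r K) * Y = 1\<^sub>m (m + k)" "Y * (W @\<^sub>r K) = 1\<^sub>m (m + k)"
    "no_pole_mat_at x (W @\<^sub>r K)"
proof -
  have R: "W @\<^sub>r K \<in> carrier_mat (m + k) (m + k)"
    using K W by auto
  have "no_pole_mat_at x (W @\<^sub>r K)"
    using K W np unfolding no_pole_mat_at_iff append_rows_def by auto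
  then show thesis
    using no_pole_inverse_mat[OF R _ d] that by blast
qed

text \<open>The last k columns Z of the inverse satisfy K Z = I. They have no pole at x, so this
  identity survives evaluation and gives both the normal rank and the rank at x.\<close>

lemma full_row_rank_if_regular_completion:
  fixes K W :: "'a :: field poly fract mat"
  assumes K: "K \<in> carrier_mat k (m + k)" and W: "W \<in> carrier_mat m (m + k)"
    and np: "no_pole_mat_at x K" "no_pole_mat_at x W"
    and d: "det (map_mat (rat_eval x) (W @\<^sub>r K)) \<noteq> 0"
  shows "full_row_rank K" "full_row_rank (map_mat (rat_eval x) K)"
proof -
  obtain Y where Y: "Y \<in> carrier_mat (m + k) (m + k)" "no_pole_mat_at x Y"
    "(W @\<^sub>r K) * Y = 1\<^sub>m (m + k)"
    using regular_completion[OF assms] by metis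
  define Z where "Z = mat (m + k) k (\<lambda>(i, j). Y $$ (i, m + j))"
  have Z: "Z \<in> carrier_mat (m + k) k" and npZ: "no_pole_mat_at x Z"
    using Y(1,2) by (auto simp: Z_def no_pole_mat_at_iff)
  have RYi: "(W * Y @\<^sub>r K * Y) $$ (i, j) = (if i = j then 1 else 0)" if "i < m + k" "j < m + k" for i j
    using Y(3) that unfolding append_rows_mult[OF W K Y(1)] by simp
  have KYi: "(K * Y) $$ (i, j) = (if i + m = j then 1 else 0)" if "i < k" "j < m + k" for i j
    using RYi[of "i + m" j] that K W Y(1) by (simp add: append_rows_def)
  have KZ: "K * Z = 1\<^sub>m k"
  proof (rule eq_matI)
    fix i j assume ij: "i < dim_row (1\<^sub>m k)" "j < dim_col (1\<^sub>m k)"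
    then have "(K * Z) $$ (i, j) = (K * Y) $$ (i, m + j)"
      using K Y(1) by (auto simp: Z_def scalar_prod_def)
    then show "(K * Z) $$ (i, j) = 1\<^sub>m k $$ (i, j)"
      using ij KYi by simp
  qed (use K Z in auto)
  then show "full_row_rank K"
    by (rule full_row_rank_if_right_inverse[OF K Z])
  have "map_mat (rat_eval x) K * map_mat (rat_eval x) Z = map_mat (rat_eval x) (1\<^sub>m k)"
    unfolding KZ[symmetric] rat_eval_mat_mult[OF K Z np(1) npZ] ..
  also have "\<dots> = 1\<^sub>m k"
    by (intro eq_matI) auto
  finally show "full_row_rank (map_mat (rat_eval x) K)"
    using K Z by (intro full_row_rank_if_right_inverse[of _ k "m + k"]) auto
qed

text \<open>The scalar a moves from \<open>M * T\<close> into the upper left block of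
  \<open>R\<^sub>1\<close>, whose determinant becomes a^m, and \<open>R\<^sub>2\<close> is the
  completion [W; K]. No identity has to be adjoined to [M; K], so the definitions of a linearization
  will be met with \<open>s\<^sub>2\<close> = 0. The same statement serves finite points and, after
  reversal, the point 0.\<close>

lemma local_linearization:
  fixes M K W G :: "'a :: field poly fract mat"
  assumes M: "M \<in> carrier_mat m (m + k)" and K: "K \<in> carrier_mat k (m + k)"
    and W: "W \<in> carrier_mat m (m + k)" and T: "T \<in> carrier_mat (m + k) m"
    and G: "G \<in> carrier_mat m m"
    and WT: "W * T = 1\<^sub>m m" and KT: "K * T = 0\<^sub>m k m" and MT: "M * T = a \<cdot>\<^sub>m G"
    and np: "no_pole_mat_at x M" "no_pole_mat_at x K" "no_pole_mat_at x W"
    and d: "det (map_mat (rat_eval x) (W @\<^sub>r K)) \<noteq> 0"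
    and a: "no_pole_at x a" "rat_eval x a \<noteq> 0"
  obtains R\<^sub>1 R\<^sub>2 where "R\<^sub>1 \<in> carrier_mat (m + k) (m + k)" "R\<^sub>2 \<in> carrier_mat (m + k) (m + k)"
    "regular_at x R\<^sub>1" "regular_at x R\<^sub>2"
    "R\<^sub>1 * diag_block_mat [G, 1\<^sub>m k] * R\<^sub>2 = M @\<^sub>r K"
proof -
  obtain Y where Y: "Y \<in> carrier_mat (m + k) (m + k)" "no_pole_mat_at x Y"
    "(W @\<^sub>r K) * Y = 1\<^sub>m (m + k)" "Y * (W @\<^sub>r K) = 1\<^sub>m (m + k)" and npR: "no_pole_mat_at x (W @\<^sub>r K)"
    using regular_completion[OF K W np(2,3) d] by metis
  define B where "B = mat m k (\<lambda>(i, j). (M * Y) $$ (i, m + j))"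
  have B: "B \<in> carrier_mat m k"
    by (simp add: B_def)
  have npB: "no_pole_mat_at x B"
    using no_pole_mat_at_mult[OF M Y(1) np(1) Y(2)] M Y(1)
    by (simp add: B_def no_pole_mat_at_iff del: index_mult_mat(1))
  define R where "R = four_block_mat (a \<cdot>\<^sub>m 1\<^sub>m m) B (0\<^sub>m k m) (1\<^sub>m k)"
  have R: "R \<in> carrier_mat (m + k) (m + k)"
    using B by (auto simp: R_def)
  have RWK: "W @\<^sub>r K \<in> carrier_mat (m + k) (m + k)"
    using W K by auto
  have "no_pole_mat_at x R"
    using npB B a(1) by (auto simp: no_pole_mat_at_iff R_def)
  moreover have "det R = a ^ m"
    unfolding R_def using B by (subst det_four_block_mat_lower_left_zero[of _ m _ k]) (auto simp: det_smult)
  moreover have "no_pole_at x (a ^ n) \<and> rat_eval x (a ^ n) = rat_eval x a ^ n" for n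
    using a(1) by (induction n) (auto simp: no_pole_at_mult rat_eval_mult)
  ultimately have "regular_at x R"
    using R a(2) by (auto simp: regular_at_def)
  moreover have "regular_at x (W @\<^sub>r K)"
    using RWK npR rat_eval_det[OF RWK npR] d by (auto simp: regular_at_def)
  moreover have "R * diag_block_mat [G, 1\<^sub>m k] * (W @\<^sub>r K) = M @\<^sub>r K"
  proof -
    have "diag_block_mat [G, 1\<^sub>m k] = four_block_mat G (0\<^sub>m m k) (0\<^sub>m k m) (1\<^sub>m k)"
      using G by (intro eq_matI) auto
    moreover have "R * \<dots> = four_block_mat (M * T) B (0\<^sub>m k m) (1\<^sub>m k)"
      unfolding R_def MT using G B
      by (subst mult_four_block_mat[of _ m m _ k _ k]) (auto simp: mult_smult_assoc_mat[of _ m m])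
    ultimately show ?thesis
      using append_rows_factorization[OF M K W T WT KT Y(1,3,4)] by (simp add: B_def)
  qed
  ultimately show thesis
    using that R RWK by blast
qed

section \<open>Indexing of block matrices\<close>

text \<open>The flat index at which block j begins. Later entry formulas address an entry as
  \<open>offset w j + b\<close> with b < w j.\<close>

definition offset :: "(nat \<Rightarrow> nat) \<Rightarrow> nat \<Rightarrow> nat" where
  "offset w j = (\<Sum>l<j. w l)"

lemma offset_0 [simp]: "offset w 0 = 0"
  and offset_Suc [simp]: "offset w (Suc j) = offset w j + w j"
  by (simp_all add: offset_def)

lemma offset_mono: "i \<le> j \<Longrightarrow> offset w i \<le> offset w j"
  unfolding offset_def by (intro sum_mono2) auto

lemma offset_add_less:
  assumes "j < k" "b < w j"
  shows "offset w j + b < offset w k"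
  using offset_mono[of "Suc j" k w] assms by simp

lemma offset_decompose:
  assumes "x < offset w k"
  obtains j b where "j < k" "b < w j" "x = offset w j + b"
proof -
  have "x < offset w k \<Longrightarrow> \<exists>j b. j < k \<and> b < w j \<and> x = offset w j + b"
  proof (induction k)
    case (Suc k)
    show ?case
    proof (cases "x < offset w k")
      case False
      then have "x = offset w k + (x - offset w k)" "x - offset w k < w k"
        using Suc.prems by auto
      then show ?thesis
        by blast
    qed (use Suc.IH less_Suc_eq in blast)
  qed simp
  then show thesis
    using assms that by blast
qed

text \<open>Splits the sum in a matrix product into one inner sum per block.\<close>

lemma sum_offset:
  fixes f :: "nat \<Rightarrow> 'b :: comm_monoid_add"
  shows "(\<Sum>x<offset w k. f x) = (\<Sum>j<k. \<Sum>b<w j. f (offset w j + b))"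
proof (induction k)
  case (Suc k)
  have "(\<Sum>x<a + c. f x) = (\<Sum>x<a. f x) + (\<Sum>b<c. f (a + b))" for a c
    by (induction c) (simp_all add: add.assoc)
  then show ?case
    by (simp add: Suc)
qed simp

text \<open>The widths are read off the list itself, which keeps the induction free of a separate
  width function. The entry formula needs the dimensions of the tail, so the three claims are proved
  as one conjunction.\<close>

lemma foldr_append_cols:
  assumes "\<And>A. A \<in> set As \<Longrightarrow> dim_row A = h"
  shows "dim_row (foldr append_cols As (0\<^sub>m h 0)) = h"
    and "dim_col (foldr append_cols As (0\<^sub>m h 0)) = offset (\<lambda>j. dim_col (As ! j)) (length As)"
    and "j < length As \<Longrightarrow> a < h \<Longrightarrow> b < dim_col (As ! j) \<Longrightarrow>
      foldr append_cols As (0\<^sub>m h 0) $$ (a, offset (\<lambda>j. dim_col (As ! j)) j + b) = As ! j $$ (a, b)"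
proof -
  have "dim_row (foldr append_cols As (0\<^sub>m h 0)) = h \<and>
    dim_col (foldr append_cols As (0\<^sub>m h 0)) = offset (\<lambda>j. dim_col (As ! j)) (length As) \<and>
    (\<forall>j a b. j < length As \<longrightarrow> a < h \<longrightarrow> b < dim_col (As ! j) \<longrightarrow>
      foldr append_cols As (0\<^sub>m h 0) $$ (a, offset (\<lambda>j. dim_col (As ! j)) j + b) = As ! j $$ (a, b))"
    using assms
  proof (induction As)
    case (Cons A As)
    define C where "C = foldr append_cols As (0\<^sub>m h 0)"
    define w where "w = (\<lambda>j. dim_col (As ! j))"
    have IH: "dim_row C = h" "dim_col C = offset w (length As)"
      "\<And>j a b. j < length As \<Longrightarrow> a < h \<Longrightarrow> b < w j \<Longrightarrow> C $$ (a, offset w j + b) = As ! j $$ (a, b)"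
      using Cons unfolding C_def w_def by auto
    \<comment> \<open>Putting A in front shifts all offsets of the tail by the width of A.\<close>
    have off: "offset (\<lambda>j. dim_col ((A # As) ! j)) (Suc j) = dim_col A + offset w j" for j
      unfolding offset_def w_def by (subst sum.lessThan_Suc_shift) simp
    have A: "dim_row A = h"
      using Cons by simp
    have e: "foldr append_cols (A # As) (0\<^sub>m h 0) = append_cols A C"
      by (simp add: C_def)
    have "append_cols A C $$ (a, offset (\<lambda>j. dim_col ((A # As) ! j)) j + b) = (A # As) ! j $$ (a, b)"
      if "j < length (A # As)" "a < h" "b < dim_col ((A # As) ! j)" for j a b
    proof (cases j)
      case 0
      then show ?thesis
        using that A IH by (simp add: append_cols_def)
    next
      case (Suc l)
      then have l: "l < length As" "b < w l"
        using that by (auto simp: w_def)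
      have "offset w l + b < offset w (length As)"
        using l by (rule offset_add_less)
      then show ?thesis
        using that A IH l unfolding Suc off by (simp add: append_cols_def add.assoc)
    qed
    moreover have "dim_col (append_cols A C) = offset (\<lambda>j. dim_col ((A # As) ! j)) (length (A # As))"
      using off[of "length As"] IH by (simp add: append_cols_def)
    ultimately show ?case
      unfolding e using A IH by (auto simp: append_cols_def)
  qed simp
  then show "dim_row (foldr append_cols As (0\<^sub>m h 0)) = h"
    "dim_col (foldr append_cols As (0\<^sub>m h 0)) = offset (\<lambda>j. dim_col (As ! j)) (length As)"
    "j < length As \<Longrightarrow> a < h \<Longrightarrow> b < dim_col (As ! j) \<Longrightarrow>
      foldr append_cols As (0\<^sub>m h 0) $$ (a, offset (\<lambda>j. dim_col (As ! j)) j + b) = As ! j $$ (a, b)"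
    by blast+
qed

lemma foldr_append_rows:
  assumes "\<And>A. A \<in> set As \<Longrightarrow> dim_col A = c"
  shows "dim_col (foldr append_rows As (0\<^sub>m 0 c)) = c"
    and "dim_row (foldr append_rows As (0\<^sub>m 0 c)) = offset (\<lambda>i. dim_row (As ! i)) (length As)"
    and "i < length As \<Longrightarrow> b < c \<Longrightarrow> a < dim_row (As ! i) \<Longrightarrow>
      foldr append_rows As (0\<^sub>m 0 c) $$ (offset (\<lambda>i. dim_row (As ! i)) i + a, b) = As ! i $$ (a, b)"
proof -
  have "dim_col (foldr append_rows As (0\<^sub>m 0 c)) = c \<and>
    dim_row (foldr append_rows As (0\<^sub>m 0 c)) = offset (\<lambda>i. dim_row (As ! i)) (length As) \<and>
    (\<forall>i a b. i < length As \<longrightarrow> b < c \<longrightarrow> a < dim_row (As ! i) \<longrightarrow>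
      foldr append_rows As (0\<^sub>m 0 c) $$ (offset (\<lambda>i. dim_row (As ! i)) i + a, b) = As ! i $$ (a, b))"
    using assms
  proof (induction As)
    case (Cons A As)
    define C where "C = foldr append_rows As (0\<^sub>m 0 c)"
    define w where "w = (\<lambda>i. dim_row (As ! i))"
    have IH: "dim_col C = c" "dim_row C = offset w (length As)"
      "\<And>i a b. i < length As \<Longrightarrow> b < c \<Longrightarrow> a < w i \<Longrightarrow> C $$ (offset w i + a, b) = As ! i $$ (a, b)"
      using Cons unfolding C_def w_def by auto
    have off: "offset (\<lambda>i. dim_row ((A # As) ! i)) (Suc i) = dim_row A + offset w i" for i
      unfolding offset_def w_def by (subst sum.lessThan_Suc_shift) simp
    have A: "dim_col A = c"
      using Cons by simp
    have e: "foldr append_rows (A # As) (0\<^sub>m 0 c) = A @\<^sub>r C"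
      by (simp add: C_def)
    have "(A @\<^sub>r C) $$ (offset (\<lambda>i. dim_row ((A # As) ! i)) i + a, b) = (A # As) ! i $$ (a, b)"
      if "i < length (A # As)" "b < c" "a < dim_row ((A # As) ! i)" for i a b
    proof (cases i)
      case 0
      then show ?thesis
        using that A IH by (simp add: append_rows_def)
    next
      case (Suc l)
      then have l: "l < length As" "a < w l"
        using that by (auto simp: w_def)
      have "offset w l + a < offset w (length As)"
        using l by (rule offset_add_less)
      then show ?thesis
        using that A IH l unfolding Suc off by (simp add: append_rows_def add.assoc)
    qed
    moreover have "dim_row (A @\<^sub>r C) = offset (\<lambda>i. dim_row ((A # As) ! i)) (length (A # As))"
      using off[of "length As"] IH by (simp add: append_rows_def)
    ultimately show ?case
      unfolding e using A IH by (auto simp: append_rows_def)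
  qed simp
  then show "dim_col (foldr append_rows As (0\<^sub>m 0 c)) = c"
    "dim_row (foldr append_rows As (0\<^sub>m 0 c)) = offset (\<lambda>i. dim_row (As ! i)) (length As)"
    "i < length As \<Longrightarrow> b < c \<Longrightarrow> a < dim_row (As ! i) \<Longrightarrow>
      foldr append_rows As (0\<^sub>m 0 c) $$ (offset (\<lambda>i. dim_row (As ! i)) i + a, b) = As ! i $$ (a, b)"
    by blast+
qed

lemma offset_cong: "(\<And>l. l < j \<Longrightarrow> v l = w l) \<Longrightarrow> offset v j = offset w j"
  by (simp add: offset_def)

lemma
  assumes "\<And>j. j < k \<Longrightarrow> B j \<in> carrier_mat h (w j)"
  shows block_row_carrier: "block_row h k B \<in> carrier_mat h (offset w k)"
    and block_row_index: "j < k \<Longrightarrow> a < h \<Longrightarrow> b < w j \<Longrightarrow>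
      block_row h k B $$ (a, offset w j + b) = B j $$ (a, b)"
proof -
  let ?As = "map B [0..<k]"
  have r: "dim_row A = h" if "A \<in> set ?As" for A
    using that assms[THEN carrier_matD(1)] by auto
  have off: "offset (\<lambda>j. dim_col (?As ! j)) j = offset w j" if "j \<le> k" for j
    using assms[THEN carrier_matD(2)] that by (intro offset_cong) auto
  show "block_row h k B \<in> carrier_mat h (offset w k)"
    using foldr_append_cols(1,2)[of ?As, OF r] off[of k] by (auto simp: block_row_def)
  assume "j < k" "a < h" "b < w j"
  then show "block_row h k B $$ (a, offset w j + b) = B j $$ (a, b)"
    using foldr_append_cols(3)[of ?As h j a b, OF r] off[of j] assms[of j] by (auto simp: block_row_def)
qed

lemma
  assumes B: "\<And>i j. i < n \<Longrightarrow> j < k \<Longrightarrow> B i j \<in> carrier_mat (h i) (w j)"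
  shows block_matrix_carrier: "block_matrix h n w k B \<in> carrier_mat (offset h n) (offset w k)"
    and block_matrix_index: "i < n \<Longrightarrow> j < k \<Longrightarrow> a < h i \<Longrightarrow> b < w j \<Longrightarrow>
      block_matrix h n w k B $$ (offset h i + a, offset w j + b) = B i j $$ (a, b)"
proof -
  let ?As = "map (\<lambda>i. block_row (h i) k (B i)) [0..<n]"
  have R: "block_row (h i) k (B i) \<in> carrier_mat (h i) (offset w k)" if "i < n" for i
    using B that by (intro block_row_carrier)
  have r: "dim_col A = offset w k" if "A \<in> set ?As" for A
    using that R[THEN carrier_matD(2)] by auto
  have off: "offset (\<lambda>i. dim_row (?As ! i)) i = offset h i" if "i \<le> n" for i
  proof (rule offset_cong)
    fix l assume "l < i"
    then show "dim_row (?As ! l) = h l"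
      using R[of l] that by auto
  qed
  have e: "block_matrix h n w k B = foldr append_rows ?As (0\<^sub>m 0 (offset w k))"
    by (simp add: block_matrix_def offset_def)
  show "block_matrix h n w k B \<in> carrier_mat (offset h n) (offset w k)"
    unfolding e using foldr_append_rows(1,2)[of ?As, OF r] off[of n] by auto
  assume ij: "i < n" "j < k" "a < h i" "b < w j"
  then have "offset w j + b < offset w k"
    by (intro offset_add_less)
  then have "block_matrix h n w k B $$ (offset h i + a, offset w j + b) =
      block_row (h i) k (B i) $$ (a, offset w j + b)"
    unfolding e using foldr_append_rows(3)[of ?As "offset w k" i "offset w j + b" a, OF r] off[of i] R[of i] ij
    by auto
  also have "\<dots> = B i j $$ (a, b)"
    using B ij by (intro block_row_index) auto
  finally show "block_matrix h n w k B $$ (offset h i + a, offset w j + b) = B i j $$ (a, b)" .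
qed

section \<open>The pencil in rational Newton form\<close>

text \<open>The units of the local ring at x. In contrast to \<open>no_pole_at\<close>, this
  property is stable under quotients.\<close>

definition unit_at :: "'a :: field \<Rightarrow> 'a poly fract \<Rightarrow> bool" where
  "unit_at x f \<longleftrightarrow> no_pole_at x f \<and> rat_eval x f \<noteq> 0"

lemma unit_at_to_fract [simp]: "unit_at x (to_fract a) \<longleftrightarrow> poly a x \<noteq> 0"
  by (simp add: unit_at_def)

lemma unit_at_rat_const [simp]: "unit_at x (rat_const c) \<longleftrightarrow> c \<noteq> 0"
  and no_pole_at_rat_const [simp]: "no_pole_at x (rat_const c)"
  by (simp_all add: rat_const_def)

lemma unit_at_mult: "unit_at x f \<Longrightarrow> unit_at x g \<Longrightarrow> unit_at x (f * g)"
  by (simp add: unit_at_def no_pole_at_mult rat_eval_mult)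

lemma unit_at_divide: "unit_at x f \<Longrightarrow> unit_at x g \<Longrightarrow> unit_at x (f / g)"
  using unit_at_mult[of x f "inverse g"]
  by (simp add: unit_at_def no_pole_at_inverse divide_inverse)

lemma unit_at_prod: "(\<And>i. i \<in> A \<Longrightarrow> unit_at x (f i)) \<Longrightarrow> unit_at x (prod f A)"
  by (cases "finite A") (auto simp: unit_at_def no_pole_at_prod rat_eval_prod)

lemma rat_const_sum: "rat_const (sum f A) = (\<Sum>i\<in>A. rat_const (f i))"
  by (induction A rule: infinite_finite_induct) simp_all

lemma to_fract_smult: "to_fract (Polynomial.smult c a) = rat_const c * to_fract a"
  by (simp add: rat_const_def flip: to_fract_mult)

lemma mat_mult_index:
  assumes "A \<in> carrier_mat k n" "B \<in> carrier_mat n l" "i < k" "j < l"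
  shows "(A * B) $$ (i, j) = (\<Sum>s<n. A $$ (i, s) * B $$ (s, j))"
  using assms by (auto simp: scalar_prod_def lessThan_atLeast0)

locale newton_pencil =
  fixes m r p N :: nat
    and \<sigma> \<beta> :: "nat \<Rightarrow> 'a :: field"
    and \<xi> :: "nat \<Rightarrow> 'a option"
    and D E :: "nat \<Rightarrow> 'a mat" and U :: "'a mat"
  assumes pN: "p + 2 \<le> N"
    and pole_nonzero: "i \<in> {1..N} \<Longrightarrow> \<xi> i \<noteq> Some 0"
    and beta_nonzero: "i \<in> {0..N} \<Longrightarrow> \<beta> i \<noteq> 0"
    and D_carrier: "i \<in> {0..p} \<Longrightarrow> D i \<in> carrier_mat m m"
    and E_carrier: "i \<in> {p+1..N} \<Longrightarrow> E i \<in> carrier_mat m r"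
    and U_carrier: "U \<in> carrier_mat m r"
begin

abbreviation "g \<equiv> newton_g \<beta> \<xi>"
abbreviation "h \<equiv> newton_h \<sigma>"
abbreviation "b \<equiv> newton_b \<beta> \<xi> \<sigma>"
abbreviation "Q \<equiv> newton_Q \<beta> \<xi> \<sigma> m p N D E U"
abbreviation "M \<equiv> newton_M \<beta> \<xi> \<sigma> m p N D E"
abbreviation "K \<equiv> newton_K \<beta> \<xi> \<sigma> m r p N U"
abbreviation "L \<equiv> newton_L \<beta> \<xi> \<sigma> m r p N D E U"

definition wd :: "nat \<Rightarrow> nat" where "wd j = (if j \<le> p then m else r)"
definition ht :: "nat \<Rightarrow> nat" where "ht i = (if i < p then m else r)"
definition rows_K :: nat where "rows_K = offset ht (N - 1)"

text \<open>In block row i of K the block g_(i+1) I is square, so that row is as high as block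
  column i + 1 is wide. Consequently K has m rows fewer than columns, m being the width of block
  column 0.\<close>

lemma wd_Suc: "wd (Suc i) = ht i"
  by (simp add: wd_def ht_def)

lemma offset_wd_Suc: "offset wd (Suc i) = m + offset ht i"
proof (induction i)
  case (Suc i)
  then show ?case
    by (metis add.assoc offset_Suc wd_Suc)
qed (simp add: wd_def)

lemma offset_wd: "offset wd N = m + rows_K"
  using offset_wd_Suc[of "N - 1"] pN by (simp add: rows_K_def del: offset_Suc)

definition gN :: "'a poly" where "gN = Polynomial.smult (1 / \<beta> N) (g N)"
definition hN :: "'a poly" where "hN = Polynomial.smult (1 / \<beta> N) (h (N - 1))"

definition M_entry :: "nat \<Rightarrow> nat \<Rightarrow> nat \<Rightarrow> 'a poly" where
  "M_entry j u s =
    (if j \<le> p then Polynomial.smult (D j $$ (u, s)) gN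
     else if j < N - 1 then Polynomial.smult (E j $$ (u, s)) gN
     else Polynomial.smult (E (N - 1) $$ (u, s)) gN + Polynomial.smult (E N $$ (u, s)) hN)"

text \<open>Entry (a, s) of the constant matrix C_i for which the diagonal block of K is -h_i C_i.
  It belongs to K, not to the dual basis \<open>T\<close>.\<close>

definition T_coeff :: "nat \<Rightarrow> nat \<Rightarrow> nat \<Rightarrow> 'a" where
  "T_coeff i a s = (if i = p then U $$ (s, a) else if a = s then 1 else 0)"

text \<open>Entry (s, v) of the product S_j = C_(j-1) ... C_0, the constant matrix in block j of the
  dual basis.\<close>

definition S_coeff :: "nat \<Rightarrow> nat \<Rightarrow> nat \<Rightarrow> 'a" where
  "S_coeff j s v = (if j \<le> p then if s = v then 1 else 0 else U $$ (v, s))"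

lemma M_carrier: "M \<in> carrier_mat m (m + rows_K)"
  and M_index: "j < N \<Longrightarrow> u < m \<Longrightarrow> s < wd j \<Longrightarrow> M $$ (u, offset wd j + s) = M_entry j u s"
proof -
  let ?B = "\<lambda>j. let gN = Polynomial.smult (1 / \<beta> N) (newton_g \<beta> \<xi> N);
         hN = Polynomial.smult (1 / \<beta> N) (newton_h \<sigma> (N - 1))
     in if j \<le> p then gN \<cdot>\<^sub>m const_mat (D j)
        else if j < N - 1 then gN \<cdot>\<^sub>m const_mat (E j)
        else gN \<cdot>\<^sub>m const_mat (E (N - 1)) + hN \<cdot>\<^sub>m const_mat (E N)"
  have EN: "E N \<in> carrier_mat m r" "E (N - 1) \<in> carrier_mat m r"
    using E_carrier pN by auto
  have B: "?B j \<in> carrier_mat m (wd j)" if "j < N" for j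
    using D_carrier[of j] E_carrier[of j] EN that by (auto simp: wd_def const_mat_def Let_def)
  show "M \<in> carrier_mat m (m + rows_K)"
    unfolding newton_M_def offset_wd[symmetric] using B by (rule block_row_carrier)
  assume js: "j < N" "u < m" "s < wd j"
  have "M $$ (u, offset wd j + s) = ?B j $$ (u, s)"
    unfolding newton_M_def using B js by (rule block_row_index)
  also have "\<dots> = M_entry j u s"
    using js D_carrier[of j] E_carrier[of j] EN
    by (auto simp: M_entry_def gN_def hN_def Let_def const_mat_def wd_def smult_add_right)
  finally show "M $$ (u, offset wd j + s) = M_entry j u s" .
qed

lemma K_carrier: "K \<in> carrier_mat rows_K (m + rows_K)"
  and K_index: "i < N - 1 \<Longrightarrow> j < N \<Longrightarrow> a < ht i \<Longrightarrow> s < wd j \<Longrightarrow>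
    K $$ (offset ht i + a, offset wd j + s) =
      (if j = i then Polynomial.smult (T_coeff i a s) (- h i)
       else if j = Suc i then if a = s then g (Suc i) else 0 else 0)"
proof -
  let ?B = "\<lambda>i j. if j = i then
             (- newton_h \<sigma> i) \<cdot>\<^sub>m (if i = p then const_mat (transpose_mat U) else 1\<^sub>m (ht i))
           else if j = i + 1 then newton_g \<beta> \<xi> (i + 1) \<cdot>\<^sub>m 1\<^sub>m (ht i)
           else 0\<^sub>m (ht i) (wd j)"
  have e: "K = block_matrix ht (N - 1) wd N ?B"
    unfolding newton_K_def Let_def wd_def[abs_def] ht_def[abs_def] ..
  have B: "?B i j \<in> carrier_mat (ht i) (wd j)" if "i < N - 1" "j < N" for i j
    using U_carrier that by (auto simp: wd_def ht_def const_mat_def)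
  show "K \<in> carrier_mat rows_K (m + rows_K)"
    using block_matrix_carrier[of "N - 1" N ?B ht wd, OF B] by (simp only: e flip: offset_wd rows_K_def)
  assume ij: "i < N - 1" "j < N" "a < ht i" "s < wd j"
  have "K $$ (offset ht i + a, offset wd j + s) = ?B i j $$ (a, s)"
    unfolding e using B ij by (rule block_matrix_index)
  also have "\<dots> = (if j = i then Polynomial.smult (T_coeff i a s) (- h i)
       else if j = Suc i then if a = s then g (Suc i) else 0 else 0)"
    using ij U_carrier by (auto simp: T_coeff_def const_mat_def wd_def ht_def split: if_splits)
  finally show "K $$ (offset ht i + a, offset wd j + s) =
      (if j = i then Polynomial.smult (T_coeff i a s) (- h i)
       else if j = Suc i then if a = s then g (Suc i) else 0 else 0)" .
qed

text \<open>The map \<phi> stands for the embedding into rational functions, for evaluation at a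
  point and for the coefficient of \<lambda>. The last is not multiplicative, so only compatibility
  with scalars and signs is assumed; \<psi> is the action on scalars.\<close>

lemma K_row_sum:
  fixes \<phi> :: "'a poly \<Rightarrow> 'b :: comm_ring_1" and \<psi> :: "'a \<Rightarrow> 'b" and f :: "nat \<Rightarrow> 'b"
  assumes \<phi>: "\<phi> 0 = 0" "\<And>c a. \<phi> (Polynomial.smult c a) = \<psi> c * \<phi> a" "\<And>a. \<phi> (- a) = - \<phi> a"
    and i: "i < N - 1" and a: "a < ht i"
  shows "(\<Sum>x<m + rows_K. \<phi> (K $$ (offset ht i + a, x)) * f x) =
    \<phi> (g (Suc i)) * f (offset wd (Suc i) + a)
      - \<phi> (h i) * (\<Sum>s<wd i. \<psi> (T_coeff i a s) * f (offset wd i + s))"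
proof -
  let ?F = "\<lambda>j. \<Sum>s<wd j. \<phi> (K $$ (offset ht i + a, offset wd j + s)) * f (offset wd j + s)"
  have "(\<Sum>x<m + rows_K. \<phi> (K $$ (offset ht i + a, x)) * f x) = (\<Sum>j<N. ?F j)"
    unfolding offset_wd[symmetric] by (rule sum_offset)
  \<comment> \<open>Block row i of K is zero outside block columns i and i + 1; both exist because i
    < N - 1.\<close>
  also have "\<dots> = (\<Sum>j\<in>{i, Suc i}. ?F j)"
    using i a \<phi>(1) by (intro sum.mono_neutral_right ballI sum.neutral) (auto simp: K_index simp del: offset_Suc)
  also have "\<dots> = ?F i + ?F (Suc i)"
    by simp
  also have "?F i = - \<phi> (h i) * (\<Sum>s<wd i. \<psi> (T_coeff i a s) * f (offset wd i + s))"
    unfolding sum_distrib_left using i a by (intro sum.cong refl) (simp add: K_index \<phi>(2,3))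
  also have "?F (Suc i) = (\<Sum>s<wd (Suc i). if s = a then \<phi> (g (Suc i)) * f (offset wd (Suc i) + a) else 0)"
    using i a \<phi>(1) by (intro sum.cong refl) (auto simp: K_index simp del: offset_Suc)
  also have "\<dots> = \<phi> (g (Suc i)) * f (offset wd (Suc i) + a)"
    using a by (simp add: wd_Suc del: offset_Suc)
  finally show ?thesis
    by simp
qed

lemma M_row_sum:
  "(\<Sum>x<m + rows_K. \<phi> (M $$ (u, x)) * f x) =
    (\<Sum>j<N. \<Sum>s<wd j. \<phi> (M_entry j u s) * f (offset wd j + s))" if "u < m"
  unfolding offset_wd[symmetric] sum_offset using that by (intro sum.cong refl) (simp add: M_index)

section \<open>The dual basis and its products with W, K and M\<close>

lemma g_nonzero: "i \<in> {1..N} \<Longrightarrow> g i \<noteq> 0"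
  using beta_nonzero[of i] by (simp add: newton_g_def)

lemma h_nonzero: "h i \<noteq> 0"
  by (simp add: newton_h_def)

lemma b_nonzero: "i \<le> N \<Longrightarrow> b i \<noteq> 0"
  using g_nonzero h_nonzero beta_nonzero[of 0] by (auto simp: newton_b_def rat_const_def)

text \<open>The two-term recurrence that the rows of K encode; it is the reason why the b_j give a
  basis dual to K.\<close>

lemma b_Suc: "i < N \<Longrightarrow> to_fract (g (Suc i)) * b (Suc i) = to_fract (h i) * b i"
  using g_nonzero[of "Suc i"] by (simp add: newton_b_def)

text \<open>The dual basis normalised to have an identity in block row \<open>q\<close>.\<close>

definition T :: "nat \<Rightarrow> 'a poly fract mat" where
  "T q = block_matrix wd N (\<lambda>_. m) 1
    (\<lambda>j _. mat (wd j) m (\<lambda>(s, v). b j / b q * rat_const (S_coeff j s v)))"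

text \<open>Polymorphic, since the same selection matrix is needed over the rational functions and,
  after evaluation, over the field.\<close>

definition W :: "nat \<Rightarrow> 'b :: zero_neq_one mat" where
  "W q = mat m (m + rows_K) (\<lambda>(u, x). if x = offset wd q + u then 1 else 0)"

lemma T_carrier: "T q \<in> carrier_mat (m + rows_K) m"
  and T_index: "j < N \<Longrightarrow> s < wd j \<Longrightarrow> v < m \<Longrightarrow>
    T q $$ (offset wd j + s, v) = b j / b q * rat_const (S_coeff j s v)"
proof -
  let ?B = "\<lambda>j (_::nat). mat (wd j) m (\<lambda>(s, v). b j / b q * rat_const (S_coeff j s v))"
  have B: "?B j i \<in> carrier_mat (wd j) m" for j i
    by simp
  show "T q \<in> carrier_mat (m + rows_K) m"
    using block_matrix_carrier[of N 1 ?B wd "\<lambda>_. m", OF B] by (simp add: T_def offset_wd)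
  show "T q $$ (offset wd j + s, v) = b j / b q * rat_const (S_coeff j s v)" if "j < N" "s < wd j" "v < m"
    using block_matrix_index[of N 1 ?B wd "\<lambda>_. m" j 0 s v, OF B] that by (simp add: T_def)
qed

lemma W_carrier: "W q \<in> carrier_mat m (m + rows_K)"
  by (simp add: W_def)

lemma W_row_sum:
  fixes f :: "nat \<Rightarrow> 'b :: comm_ring_1"
  assumes "q \<le> p" "u < m"
  shows "(\<Sum>x<m + rows_K. W q $$ (u, x) * f x) = f (offset wd q + u)"
proof -
  \<comment> \<open>For q <= p block column q has width m, so all m selected indices are in
    range.\<close>
  have "offset wd q + u < m + rows_K"
    unfolding offset_wd[symmetric] using assms pN by (intro offset_add_less) (auto simp: wd_def)
  moreover have "(\<Sum>x<m + rows_K. W q $$ (u, x) * f x) = (\<Sum>x<m + rows_K. if x = offset wd q + u then f (offset wd q + u) else 0)"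
    using assms by (intro sum.cong refl) (auto simp: W_def)
  ultimately show ?thesis
    by simp
qed

lemma W_T:
  assumes "q \<le> p"
  shows "W q * T q = 1\<^sub>m m"
proof (rule eq_matI)
  fix u v assume "u < dim_row (1\<^sub>m m :: 'a poly fract mat)" "v < dim_col (1\<^sub>m m :: 'a poly fract mat)"
  then have uv: "u < m" "v < m"
    by simp_all
  have "(W q * T q) $$ (u, v) = T q $$ (offset wd q + u, v)"
    using mat_mult_index[OF W_carrier T_carrier uv] W_row_sum[OF assms uv(1)] by simp
  also have "\<dots> = (if u = v then 1 else 0)"
    using assms uv pN b_nonzero[of q] by (simp add: T_index wd_def S_coeff_def)
  finally show "(W q * T q) $$ (u, v) = 1\<^sub>m m $$ (u, v)"
    using uv by simp
qed (simp_all add: W_def T_carrier[THEN carrier_matD(2)])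

text \<open>In matrix form C_i S_i = S_(i+1). One term of the sum survives: s = v for i = p, because
  S_p = I, and s = a otherwise, because C_i = I.\<close>

lemma T_S_coeff:
  assumes "a < ht i" "v < m"
  shows "(\<Sum>s<wd i. T_coeff i a s * S_coeff i s v) = S_coeff (Suc i) a v"
proof -
  have "(\<Sum>s<wd i. T_coeff i a s * S_coeff i s v) =
      (\<Sum>s<wd i. if s = (if i = p then v else a) then S_coeff (Suc i) a v else 0)"
    using assms by (intro sum.cong refl) (auto simp: T_coeff_def S_coeff_def)
  also have "\<dots> = S_coeff (Suc i) a v"
    using assms by (auto simp: ht_def wd_def)
  finally show ?thesis .
qed

text \<open>Up to division by b_q, block row i reads g_(i+1) b_(i+1) S_(i+1) = h_i b_i C_i S_i, the
  recurrence of the b_i combined with that of the S_i.\<close>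

lemma K_T: "rat_mat K * T q = 0\<^sub>m rows_K m"
proof (rule eq_matI)
  fix x v assume "x < dim_row (0\<^sub>m rows_K m :: 'a poly fract mat)" "v < dim_col (0\<^sub>m rows_K m :: 'a poly fract mat)"
  then have xv: "x < rows_K" "v < m"
    by simp_all
  then obtain i a where ia: "i < N - 1" "a < ht i" "x = offset ht i + a"
    unfolding rows_K_def by (rule_tac offset_decompose)
  have iN: "i < N" "Suc i < N" "a < wd (Suc i)"
    using ia by (auto simp: wd_Suc)
  have "(rat_mat K * T q) $$ (x, v) = (\<Sum>y<m + rows_K. to_fract (K $$ (x, y)) * T q $$ (y, v))"
    using mat_mult_index[of "rat_mat K" rows_K, OF _ T_carrier xv] K_carrier xv
    by (auto simp: rat_mat_def intro!: sum.cong)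
  also have "\<dots> = to_fract (g (Suc i)) * T q $$ (offset wd (Suc i) + a, v)
      - to_fract (h i) * (\<Sum>s<wd i. rat_const (T_coeff i a s) * T q $$ (offset wd i + s, v))"
    unfolding ia(3) using ia(1,2) by (intro K_row_sum) (auto simp: to_fract_smult)
  also have "(\<Sum>s<wd i. rat_const (T_coeff i a s) * T q $$ (offset wd i + s, v)) =
      b i / b q * rat_const (\<Sum>s<wd i. T_coeff i a s * S_coeff i s v)"
    unfolding rat_const_sum sum_distrib_left using iN xv
    by (intro sum.cong refl) (simp add: T_index)
  also have "to_fract (h i) * (b i / b q * rat_const (\<Sum>s<wd i. T_coeff i a s * S_coeff i s v)) =
      to_fract (g (Suc i)) * T q $$ (offset wd (Suc i) + a, v)"
    using b_Suc[OF iN(1)] iN xv by (simp add: T_S_coeff ia T_index del: offset_Suc)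
  finally show "(rat_mat K * T q) $$ (x, v) = 0\<^sub>m rows_K m $$ (x, v)"
    using xv by simp
qed (use K_carrier T_carrier[of q] in \<open>auto simp: rat_mat_def\<close>)

text \<open>The scalar a: its numerator comes from M and its denominator from the normalisation of
  \<open>T q\<close>.\<close>

definition factor :: "nat \<Rightarrow> 'a poly fract" where
  "factor q = to_fract gN / b q"

text \<open>Blocks 0 to N - 1 of the dual basis produce the terms b_0 to b_(N-1) of Q through g_N.
  The missing term b_N comes from the second summand of the last block column, because h_(N-1)
  b_(N-1) = g_N b_N.\<close>

lemma M_T: "rat_mat M * T q = factor q \<cdot>\<^sub>m Q"
proof (rule eq_matI)
  fix u v assume "u < dim_row (factor q \<cdot>\<^sub>m Q)" "v < dim_col (factor q \<cdot>\<^sub>m Q)"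
  then have uv: "u < m" "v < m"
    by (simp_all add: newton_Q_def)
  define d where "d j = rat_const (if j \<le> p then D j $$ (u, v) else (E j * transpose_mat U) $$ (u, v))" for j
  have EU: "(E j * transpose_mat U) $$ (u, v) = (\<Sum>s<r. E j $$ (u, s) * U $$ (v, s))" if "j \<in> {p+1..N}" for j
    using E_carrier[OF that] U_carrier uv by (auto simp: scalar_prod_def lessThan_atLeast0)
  have d': "d j = (\<Sum>s<r. rat_const (E j $$ (u, s) * U $$ (v, s)))" if "j \<in> {p+1..N}" for j
    using EU[OF that] that unfolding d_def by (simp add: rat_const_sum)
  have hb: "to_fract hN * b (N - 1) = to_fract gN * b N"
    using b_Suc[of "N - 1"] pN by (simp add: gN_def hN_def to_fract_smult)
  let ?F = "\<lambda>j. \<Sum>s<wd j. to_fract (M_entry j u s) * T q $$ (offset wd j + s, v)"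
  have F: "?F j = factor q * (b j * d j)" if "j < N - 1" for j
  proof (cases "j \<le> p")
    case True
    have "?F j = (\<Sum>s<m. if s = v then factor q * (b j * d j) else 0)"
      using True that uv by (intro sum.cong)
        (auto simp: wd_def T_index M_entry_def S_coeff_def d_def to_fract_smult factor_def)
    then show ?thesis
      using uv by simp
  next
    case False
    then have "d j = (\<Sum>s<r. rat_const (E j $$ (u, s) * U $$ (v, s)))"
      using that by (intro d') auto
    then show ?thesis
      using False that uv by (simp add: sum_distrib_left wd_def T_index M_entry_def S_coeff_def
          to_fract_smult factor_def mult_ac)
  qed
  \<comment> \<open>By p + 2 <= N the last block column lies to the right of p, so it has width r
    and the dual basis has U^T there.\<close>
  have "?F (N - 1) = (\<Sum>s<r. (to_fract gN * rat_const (E (N - 1) $$ (u, s)) + to_fract hN * rat_const (E N $$ (u, s)))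
      * (b (N - 1) / b q * rat_const (U $$ (v, s))))"
    using pN uv by (intro sum.cong) (auto simp: wd_def T_index M_entry_def S_coeff_def to_fract_smult)
  also have "\<dots> = (\<Sum>s<r. factor q * (b (N - 1) * rat_const (E (N - 1) $$ (u, s) * U $$ (v, s)))
      + to_fract hN * b (N - 1) / b q * rat_const (E N $$ (u, s) * U $$ (v, s)))"
    by (intro sum.cong refl) (simp add: factor_def algebra_simps)
  also have "\<dots> = factor q * (b (N - 1) * d (N - 1)) + factor q * (b N * d N)"
    using pN unfolding sum.distrib hb by (simp add: d' sum_distrib_left factor_def mult_ac)
  finally have FN: "?F (N - 1) = factor q * (b (N - 1) * d (N - 1)) + factor q * (b N * d N)" .
  have split: "{..<N} = insert (N - 1) {..<N - 1}" "{0..N} = insert N (insert (N - 1) {..<N - 1})"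
    using pN by auto
  have "(rat_mat M * T q) $$ (u, v) = (\<Sum>x<m + rows_K. to_fract (M $$ (u, x)) * T q $$ (x, v))"
    using mat_mult_index[of "rat_mat M" m, OF _ T_carrier uv] M_carrier uv
    by (auto simp: rat_mat_def intro!: sum.cong)
  also have "\<dots> = (\<Sum>j<N. ?F j)"
    using uv by (rule_tac M_row_sum)
  also have "\<dots> = ?F (N - 1) + (\<Sum>j<N - 1. ?F j)"
    unfolding split(1) by (intro sum.insert) auto
  also have "(\<Sum>j<N - 1. ?F j) = (\<Sum>j<N - 1. factor q * (b j * d j))"
    by (intro sum.cong refl F) simp
  also have "?F (N - 1) + \<dots> = factor q * (\<Sum>j = 0..N. b j * d j)"
  proof -
    have "N \<notin> insert (N - 1) {..<N - 1}"
      using pN by auto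
    then show ?thesis
      unfolding split(2) FN by (simp add: sum_distrib_left distrib_left)
  qed
  also have "{0..N} = {0..p} \<union> {p+1..N}"
    using pN by auto
  also have "(\<Sum>j\<in>{0..p} \<union> {p+1..N}. b j * d j) = Q $$ (u, v)"
    using uv by (subst sum.union_disjoint) (auto simp: newton_Q_def d_def)
  finally show "(rat_mat M * T q) $$ (u, v) = (factor q \<cdot>\<^sub>m Q) $$ (u, v)"
    using uv by (simp add: newton_Q_def)
qed (use M_carrier T_carrier[of q] in \<open>auto simp: rat_mat_def newton_Q_def\<close>)

text \<open>A kernel vector y vanishes in block q because of W. Each row of K relates neighbouring
  blocks: dividing by \<phi> (g (Suc i)) propagates the zeros to the right, dividing by \<phi> (h i)
  to the left. Keeping \<phi> abstract covers evaluation at a finite point and the coefficient of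
  \<lambda>, which is evaluation of the reversal at 0.\<close>

lemma det_W_K_nonzero:
  fixes \<phi> :: "'a poly \<Rightarrow> 'a"
  assumes \<phi>: "\<phi> 0 = 0" "\<And>c a. \<phi> (Polynomial.smult c a) = c * \<phi> a" "\<And>a. \<phi> (- a) = - \<phi> a"
    and q: "q \<le> p"
    and h_unit: "\<And>i. i < q \<Longrightarrow> \<phi> (h i) \<noteq> 0"
    and g_unit: "\<And>i. q \<le> i \<Longrightarrow> i < N - 1 \<Longrightarrow> \<phi> (g (Suc i)) \<noteq> 0"
  shows "det (W q @\<^sub>r map_mat \<phi> K) \<noteq> 0"
proof
  have mK: "map_mat \<phi> K \<in> carrier_mat rows_K (m + rows_K)"
    using K_carrier by simp
  assume "det (W q @\<^sub>r map_mat \<phi> K) = 0"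
  moreover have R: "W q @\<^sub>r map_mat \<phi> K \<in> carrier_mat (m + rows_K) (m + rows_K)"
    by (rule carrier_append_rows[OF W_carrier mK])
  ultimately obtain y where y: "y \<in> carrier_vec (m + rows_K)" "y \<noteq> 0\<^sub>v (m + rows_K)"
    "(W q @\<^sub>r map_mat \<phi> K) *\<^sub>v y = 0\<^sub>v (m + rows_K)"
    using det_0_iff_vec_prod_zero_field[OF R] by blast
  have row: "(\<Sum>x<m + rows_K. (W q @\<^sub>r map_mat \<phi> K) $$ (l, x) * y $ x) = 0" if "l < m + rows_K" for l
  proof -
    have "(\<Sum>x<m + rows_K. (W q @\<^sub>r map_mat \<phi> K) $$ (l, x) * y $ x) = ((W q @\<^sub>r map_mat \<phi> K) *\<^sub>v y) $ l"
      using that R y(1) by (auto simp: scalar_prod_def lessThan_atLeast0)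
    then show ?thesis
      using that y(3) by simp
  qed
  have start: "y $ (offset wd q + u) = 0" if "u < wd q" for u
  proof -
    have u: "u < m"
      using that q by (simp add: wd_def)
    have "(\<Sum>x<m + rows_K. (W q @\<^sub>r map_mat \<phi> K) $$ (u, x) * y $ x) = (\<Sum>x<m + rows_K. W q $$ (u, x) * y $ x)"
      using u by (intro sum.cong refl) (simp add: append_rows_index[OF W_carrier mK])
    then show ?thesis
      using row[of u] u W_row_sum[OF q u, of "\<lambda>x. y $ x"] by simp
  qed
  have recurrence: "\<phi> (g (Suc i)) * y $ (offset wd (Suc i) + a) =
      \<phi> (h i) * (\<Sum>s<wd i. T_coeff i a s * y $ (offset wd i + s))"
    if "i < N - 1" "a < ht i" for i a
  proof -
    have x: "offset ht i + a < rows_K"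
      unfolding rows_K_def using that by (intro offset_add_less)
    have "(\<Sum>x<m + rows_K. (W q @\<^sub>r map_mat \<phi> K) $$ (m + (offset ht i + a), x) * y $ x) =
        (\<Sum>x<m + rows_K. \<phi> (K $$ (offset ht i + a, x)) * y $ x)"
      using x K_carrier by (intro sum.cong refl) (simp add: append_rows_index[OF W_carrier mK])
    then show ?thesis
      using row[of "m + (offset ht i + a)"] x K_row_sum[of \<phi> "\<lambda>c. c", OF \<phi> that, of "\<lambda>x. y $ x"]
      by (simp del: offset_Suc)
  qed
  have up: "\<forall>s<wd j. y $ (offset wd j + s) = 0" if "q \<le> j" "j < N" for j
    using that
  proof (induction j rule: dec_induct)
    case (step j)
    show ?case
    proof (intro allI impI)
      fix s assume "s < wd (Suc j)"
      then have "\<phi> (g (Suc j)) * y $ (offset wd (Suc j) + s) = 0"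
        using recurrence[of j s] step by (simp add: wd_Suc del: offset_Suc)
      then show "y $ (offset wd (Suc j) + s) = 0"
        using g_unit[of j] step by (simp del: offset_Suc)
    qed
  qed (use start in simp)
  have down: "\<forall>s<wd j. y $ (offset wd j + s) = 0" if "j \<le> q" for j
    using that
  proof (induction j rule: inc_induct)
    case (step j)
    show ?case
    proof (intro allI impI)
      fix s assume s: "s < wd j"
      have j: "j < q" "j < p" "j < N - 1"
        using step q pN by auto
      then have "s < ht j" "s < wd (Suc j)"
        using s by (auto simp: wd_def ht_def)
      \<comment> \<open>Here j < q <= p, so C_j is an identity and the sum is the single coordinate
        to be shown zero. At row p only its image under U^T would be controlled.\<close>
      have "(\<Sum>l<wd j. T_coeff j s l * y $ (offset wd j + l)) =
          (\<Sum>l<wd j. if l = s then y $ (offset wd j + s) else 0)"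
        using j by (intro sum.cong refl) (auto simp: T_coeff_def)
      also have "\<dots> = y $ (offset wd j + s)"
        using s by simp
      finally have "\<phi> (h j) * y $ (offset wd j + s) = 0"
        using recurrence[OF j(3) \<open>s < ht j\<close>] step \<open>s < wd (Suc j)\<close> by (simp del: offset_Suc)
      then show "y $ (offset wd j + s) = 0"
        using h_unit[OF j(1)] by simp
    qed
  qed (use start in simp)
  have "y = 0\<^sub>v (m + rows_K)"
  proof (rule eq_vecI)
    fix x assume "x < dim_vec (0\<^sub>v (m + rows_K) :: 'a vec)"
    then have "x < offset wd N"
      by (simp add: offset_wd)
    then obtain j s where "j < N" "s < wd j" "x = offset wd j + s"
      by (rule offset_decompose)
    then have "y $ x = 0"
      using up[of j] down[of j] by (cases "j \<le> q") auto
    then show "y $ x = 0\<^sub>v (m + rows_K) $ x"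
      using \<open>x < dim_vec _\<close> by simp
  qed (use y in simp)
  then show False
    using y by simp
qed

end

lemma diag_block_mat_one_0: "diag_block_mat [A, 1\<^sub>m 0] = A"
  by (intro eq_matI) (auto simp: Let_def)

context newton_pencil
begin

section \<open>Points outside the finite poles\<close>

lemma no_pole_W: "no_pole_mat_at x (W q)"
  and rat_eval_W: "map_mat (rat_eval x) (W q) = W q"
  by (auto simp: no_pole_mat_at_iff W_def)

lemma Q_carrier: "Q \<in> carrier_mat m m"
  by (simp add: newton_Q_def)

lemma poly_g_nonzero:
  assumes "x \<notin> finite_poles \<xi> N" "i \<in> {1..N}"
  shows "poly (g i) x \<noteq> 0"
proof (cases "\<xi> i")
  case (Some y)
  then have "x \<noteq> y" "y \<noteq> 0"
    using assms pole_nonzero[of i] by (auto simp: finite_poles_def)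
  then show ?thesis
    using Some beta_nonzero[of i] assms(2) by (simp add: newton_g_def inverse_pole_def field_simps)
qed (use beta_nonzero[of i] assms(2) in \<open>simp add: newton_g_def inverse_pole_def\<close>)

lemma no_pole_rat_mat: "no_pole_mat_at x (rat_mat A)"
  by (auto simp: no_pole_mat_at_iff rat_mat_def)

lemma rat_carriers: "rat_mat M \<in> carrier_mat m (m + rows_K)" "rat_mat K \<in> carrier_mat rows_K (m + rows_K)"
  using M_carrier K_carrier by (simp_all add: rat_mat_def)

lemma det_completion_finite:
  assumes "x \<notin> finite_poles \<xi> N"
  shows "det (map_mat (rat_eval x) (W 0 @\<^sub>r rat_mat K)) \<noteq> 0"
proof -
  have "map_mat (rat_eval x) (W 0 @\<^sub>r rat_mat K) = W 0 @\<^sub>r map_mat (\<lambda>a. poly a x) K"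
    unfolding map_mat_append_rows[OF W_carrier rat_carriers(2)] rat_eval_W
    by (intro arg_cong2[of _ _ _ _ append_rows] eq_matI) (auto simp: rat_mat_def)
  moreover have "det (W 0 @\<^sub>r map_mat (\<lambda>a. poly a x) K) \<noteq> 0"
    by (rule det_W_K_nonzero) (use poly_g_nonzero[OF assms] in auto)
  ultimately show ?thesis
    by simp
qed

lemma unit_at_b_0: "unit_at x (b 0)"
  using beta_nonzero[of 0] by (simp add: newton_b_def)

lemma no_pole_b:
  assumes "x \<notin> finite_poles \<xi> N" "i \<le> N"
  shows "no_pole_at x (b i)"
proof -
  have "no_pole_at x (to_fract (h (k - 1)) / to_fract (g k))" if "k \<in> {1..i}" for k
    unfolding divide_inverse using poly_g_nonzero[OF assms(1), of k] assms(2) that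
    by (intro no_pole_at_mult no_pole_at_inverse) auto
  then show ?thesis
    unfolding newton_b_def by (intro no_pole_at_mult no_pole_at_prod) auto
qed

text \<open>Since b_0 is a nonzero constant, only g_N matters, and its one possible zero is the pole
  \<xi>_N.\<close>

lemma unit_at_factor:
  assumes "x \<notin> finite_poles \<xi> N"
  shows "unit_at x (factor 0)"
  unfolding factor_def using poly_g_nonzero[OF assms, of N] beta_nonzero[of N] pN
  by (intro unit_at_divide unit_at_b_0) (simp add: gN_def)

lemma no_pole_T:
  assumes "x \<notin> finite_poles \<xi> N"
  shows "no_pole_mat_at x (T 0)"
  unfolding no_pole_mat_at_iff
proof (intro allI impI)
  fix y v assume "y < dim_row (T 0)" "v < dim_col (T 0)"
  then have "y < offset wd N" "v < m"
    using T_carrier[of 0] by (auto simp: offset_wd)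
  then obtain j s where js: "j < N" "s < wd j" "y = offset wd j + s"
    by (rule_tac offset_decompose)
  have "no_pole_at x (b j / b 0 * rat_const (S_coeff j s v))"
    unfolding divide_inverse using no_pole_b[OF assms, of j] unit_at_b_0[of x] js
    by (intro no_pole_at_mult no_pole_at_inverse) (auto simp: unit_at_def)
  then show "no_pole_at x (T 0 $$ (y, v))"
    using js \<open>v < m\<close> by (simp add: T_index)
qed

lemma T_W_transpose: "transpose_mat (T 0) * transpose_mat (W 0) = 1\<^sub>m m"
  using transpose_mult[OF W_carrier T_carrier, of 0 0] W_T[of 0] by simp

text \<open>The transpose of \<open>W 0\<close> is a constant right inverse, so it stays one after
  evaluation at any point where \<open>T 0\<close> has no pole.\<close>

lemma full_row_rank_in_dual: "full_row_rank_in (transpose_mat (T 0)) (UNIV - finite_poles \<xi> N)"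
  unfolding full_row_rank_in_def
proof (intro ballI conjI)
  fix x assume "x \<in> UNIV - finite_poles \<xi> N"
  then have np: "no_pole_mat_at x (transpose_mat (T 0))"
    using no_pole_T[of x] by (auto simp: no_pole_mat_at_iff)
  then show "no_pole_mat_at x (transpose_mat (T 0))" .
  have c: "transpose_mat (T 0) \<in> carrier_mat m (m + rows_K)"
    "transpose_mat (W 0) \<in> carrier_mat (m + rows_K) m"
    using T_carrier W_carrier by auto
  have "no_pole_mat_at x (transpose_mat (W 0))"
    using no_pole_W[of x 0] by (auto simp: no_pole_mat_at_iff)
  then have "map_mat (rat_eval x) (transpose_mat (T 0)) * map_mat (rat_eval x) (transpose_mat (W 0)) =
      map_mat (rat_eval x) (1\<^sub>m m)"
    using rat_eval_mat_mult[OF c np] T_W_transpose by simp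
  also have "\<dots> = 1\<^sub>m m"
    by (intro eq_matI) auto
  finally show "full_row_rank (map_mat (rat_eval x) (transpose_mat (T 0)))"
    using c by (intro full_row_rank_if_right_inverse[of _ m "m + rows_K"]) auto
qed

text \<open>Supplies a sample point: full row normal rank of K and \<open>factor 0\<close> \<noteq>
  0 are both deduced from regularity at 0.\<close>

lemma zero_not_finite_pole: "0 \<notin> finite_poles \<xi> N"
  using pole_nonzero by (auto simp: finite_poles_def)

lemma degree_M_entry: "degree (M_entry j u s) \<le> 1"
  by (auto simp: M_entry_def gN_def hN_def newton_g_def newton_h_def intro!: degree_add_le)

lemma degree_K_index:
  assumes "x < rows_K" "y < m + rows_K"
  shows "degree (K $$ (x, y)) \<le> 1"
proof -
  obtain i a where i: "i < N - 1" "a < ht i" "x = offset ht i + a"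
    using assms(1) unfolding rows_K_def by (rule offset_decompose)
  obtain j s where j: "j < N" "s < wd j" "y = offset wd j + s"
    using assms(2) unfolding offset_wd[symmetric] by (rule offset_decompose)
  show ?thesis
    unfolding i(3) j(3) K_index[OF i(1) j(1) i(2) j(2)] by (simp add: newton_g_def newton_h_def)
qed

lemma degree_M_index:
  assumes "u < m" "y < m + rows_K"
  shows "degree (M $$ (u, y)) \<le> 1"
proof -
  obtain j s where j: "j < N" "s < wd j" "y = offset wd j + s"
    using assms(2) unfolding offset_wd[symmetric] by (rule offset_decompose)
  then show ?thesis
    using assms(1) degree_M_entry by (simp add: M_index)
qed

lemma L_eq: "L = M @\<^sub>r K"
  by (simp add: newton_L_def)

lemma L_carrier: "L \<in> carrier_mat (m + rows_K) (m + rows_K)"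
  unfolding L_eq by (rule carrier_append_rows[OF M_carrier K_carrier])

lemma dims: "dim_row L = m + rows_K" "dim_col L = m + rows_K" "dim_row Q = m"
  using L_carrier by (auto simp: newton_Q_def)

lemma L_index:
  assumes "i < m + rows_K" "j < m + rows_K"
  shows "L $$ (i, j) = (if i < m then M $$ (i, j) else K $$ (i - m, j))"
  unfolding L_eq by (rule append_rows_index[OF M_carrier K_carrier assms])

lemma finite_elements_mat: "finite (elements_mat A)"
  by (simp add: elements_mat_def)

lemma pencil_L: "pencil L"
proof -
  have "degree a \<le> 1" if "a \<in> elements_mat L" for a
    using elements_matD[OF that] L_carrier degree_M_index degree_K_index by (auto simp: L_index)
  then show ?thesis
    using finite_elements_mat[of L] by (auto simp: pencil_def degree_mat_def)
qed

lemma rat_mat_L: "rat_mat L = rat_mat M @\<^sub>r rat_mat K"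
  unfolding L_eq rat_mat_def by (rule map_mat_append_rows[OF M_carrier K_carrier])

lemma block_full_rank: "block_full_rank_pencil L M K"
  unfolding block_full_rank_pencil_def
  using pencil_L L_eq M_carrier K_carrier
    full_row_rank_if_regular_completion(1)[OF rat_carriers(2) W_carrier no_pole_rat_mat no_pole_W
      det_completion_finite[OF zero_not_finite_pole]]
  by auto

text \<open>Take the dual basis to be the transpose of \<open>T 0\<close>. The product with M is
  then \<open>factor 0\<close> times Q, and the scalar matrix \<open>?N2\<close> cancels this
  unit.\<close>

lemma associated: "associated_in M K Q (UNIV - finite_poles \<xi> N)"
  unfolding associated_in_def
proof (intro exI conjI)
  let ?N = "transpose_mat (T 0)" and ?N2 = "inverse (factor 0) \<cdot>\<^sub>m 1\<^sub>m m"
  have c: "?N \<in> carrier_mat m (m + rows_K)" "transpose_mat (W 0) \<in> carrier_mat (m + rows_K) m"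
    using T_carrier W_carrier by auto
  show "dual_rational_basis K ?N"
    unfolding dual_rational_basis_def
    using K_T[of 0] K_carrier c full_row_rank_if_right_inverse[OF c T_W_transpose]
    by auto
  show "?N2 \<in> carrier_mat (dim_row M) (dim_row M)"
    using M_carrier by auto
  show "\<forall>x\<in>UNIV - finite_poles \<xi> N. regular_at x ?N2"
  proof
    fix x assume "x \<in> UNIV - finite_poles \<xi> N"
    then have "unit_at x (1 / factor 0)"
      using unit_at_factor[of x] by (intro unit_at_divide) (auto simp: unit_at_def)
    then have u: "unit_at x (inverse (factor 0))"
      by (simp add: divide_inverse)
    \<comment> \<open>This power is the determinant of \<open>?N2\<close>.\<close>
    moreover have "unit_at x (inverse (factor 0) ^ m)"
      using unit_at_prod[of "{..<m}" x "\<lambda>_. inverse (factor 0)"] u by simp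
    ultimately show "regular_at x ?N2"
      by (auto simp: regular_at_def unit_at_def no_pole_mat_at_iff det_smult)
  qed
  show "full_row_rank_in (rat_mat K) (UNIV - finite_poles \<xi> N)"
    unfolding full_row_rank_in_def
    using no_pole_rat_mat full_row_rank_if_regular_completion(2)[OF rat_carriers(2) W_carrier no_pole_rat_mat no_pole_W
      det_completion_finite] by auto
  show "full_row_rank_in ?N (UNIV - finite_poles \<xi> N)"
    by (rule full_row_rank_in_dual)
  have "factor 0 \<noteq> 0"
    using unit_at_factor[OF zero_not_finite_pole] by (auto simp: unit_at_def)
  have "?N2 * rat_mat M = inverse (factor 0) \<cdot>\<^sub>m rat_mat M"
    using rat_carriers(1) by (simp add: mult_smult_assoc_mat[of _ m m])
  then have "?N2 * rat_mat M * T 0 = inverse (factor 0) \<cdot>\<^sub>m (factor 0 \<cdot>\<^sub>m Q)"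
    using mult_smult_assoc_mat[OF rat_carriers(1) T_carrier] M_T[of 0] by simp
  also have "\<dots> = Q"
    using \<open>factor 0 \<noteq> 0\<close> by (intro eq_matI) auto
  finally show "Q = ?N2 * rat_mat M * transpose_mat ?N"
    by simp
qed

lemma linearization_finite: "linearization_in L Q (UNIV - finite_poles \<xi> N)"
  unfolding linearization_in_def Let_def
proof (intro conjI ballI)
  show "pencil L" "square_mat Q"
    using pencil_L Q_carrier by auto
  fix x assume x: "x \<in> UNIV - finite_poles \<xi> N"
  have u: "no_pole_at x (factor 0)" "rat_eval x (factor 0) \<noteq> 0"
    using unit_at_factor[of x] x by (auto simp: unit_at_def)
  have "det (map_mat (rat_eval x) (W 0 @\<^sub>r rat_mat K)) \<noteq> 0"
    using det_completion_finite x by blast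
  then obtain R\<^sub>1 R\<^sub>2 where R: "R\<^sub>1 \<in> carrier_mat (m + rows_K) (m + rows_K)" "R\<^sub>2 \<in> carrier_mat (m + rows_K) (m + rows_K)"
    "regular_at x R\<^sub>1" "regular_at x R\<^sub>2"
    "R\<^sub>1 * diag_block_mat [Q, 1\<^sub>m rows_K] * R\<^sub>2 = rat_mat M @\<^sub>r rat_mat K"
    using local_linearization[OF rat_carriers W_carrier T_carrier Q_carrier W_T[OF le0] K_T M_T
        no_pole_rat_mat no_pole_rat_mat no_pole_W _ u] by blast
  show "\<exists>s\<^sub>1 s\<^sub>2 R\<^sub>1 R\<^sub>2. int s\<^sub>1 - int s\<^sub>2 = int (dim_row L) - int (dim_row Q) \<and>
      int s\<^sub>1 - int s\<^sub>2 = int (dim_col L) - int (dim_row Q) \<and>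
      R\<^sub>1 \<in> carrier_mat (dim_row Q + s\<^sub>1) (dim_row Q + s\<^sub>1) \<and>
      R\<^sub>2 \<in> carrier_mat (dim_row Q + s\<^sub>1) (dim_row Q + s\<^sub>1) \<and>
      regular_at x R\<^sub>1 \<and> regular_at x R\<^sub>2 \<and>
      R\<^sub>1 * diag_block_mat [Q, 1\<^sub>m s\<^sub>1] * R\<^sub>2 = diag_block_mat [rat_mat L, 1\<^sub>m s\<^sub>2]"
    unfolding dims
    by (intro exI[of _ rows_K] exI[of _ 0] exI[of _ R\<^sub>1] exI[of _ R\<^sub>2] conjI R(1-4))
      (simp_all only: diag_block_mat_one_0 R(5) rat_mat_L of_nat_add of_nat_0 add_diff_cancel_left' diff_zero)
qed

section \<open>The point at infinity\<close>

lemma rev_mat_rat_mat: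
  assumes "A \<in> carrier_mat k l" "\<And>i j. i < k \<Longrightarrow> j < l \<Longrightarrow> degree (A $$ (i, j)) \<le> 1"
  shows "rev_mat 1 (rat_mat A) = map_mat (\<lambda>a. to_fract [:coeff a 1, coeff a 0:]) A"
  using assms by (intro eq_matI)
    (auto simp: rev_mat_def rat_mat_def rat_recip_to_fract rat_X_mult_poly_recip_linear)

text \<open>The whole grade is charged to the first factor: M and K are reversed with grade 1,
  whereas in the dual basis \<lambda> is merely replaced by 1/\<lambda>.\<close>

lemma rev_mat_mult:
  assumes "A \<in> carrier_mat k n" "B \<in> carrier_mat n l"
  shows "rev_mat e (A * B) = rev_mat e A * map_mat rat_recip B"
proof -
  have rev: "rev_mat e C = rat_X powi e \<cdot>\<^sub>m map_mat rat_recip C" for C :: "'b :: field poly fract mat"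
    by (intro eq_matI) (auto simp: rev_mat_def)
  show ?thesis
    unfolding rev using rat_recip.mat_hom_mult[OF assms] mult_smult_assoc_mat[of "map_mat rat_recip A" k n] assms
    by simp
qed

text \<open>The order of the zero at 0 of the reversal of g_k.\<close>

definition pole_order :: "nat \<Rightarrow> nat" where
  "pole_order k = (if \<xi> k = None then 1 else 0)"

text \<open>The reversal of g_k is \<beta>_k (\<lambda> - 1/\<xi>_k). It is \<beta>_k \<lambda> for
  an infinite pole and takes the nonzero value -\<beta>_k / \<xi>_k at 0 for a finite one.\<close>

lemma rat_X_recip_g:
  assumes "k \<in> {1..N}"
  obtains u where "unit_at 0 u" "rat_X * rat_recip (to_fract (g k)) = u * rat_X ^ pole_order k"
proof -
  have d: "degree (g k) \<le> 1"
    by (simp add: newton_g_def)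
  have e: "rat_X * rat_recip (to_fract (g k)) = to_fract [: - \<beta> k * inverse_pole (\<xi> k), \<beta> k:]"
    unfolding rat_recip_to_fract rat_X_mult_poly_recip_linear[OF d] by (simp add: newton_g_def)
  show thesis
  proof (cases "\<xi> k")
    case None
    then have "rat_X * rat_recip (to_fract (g k)) = rat_const (\<beta> k) * rat_X ^ pole_order k"
      unfolding e by (simp add: pole_order_def inverse_pole_def rat_X_def rat_const_def flip: to_fract_mult)
    then show thesis
      using that[of "rat_const (\<beta> k)"] beta_nonzero[of k] assms by simp
  next
    case (Some y)
    then show thesis
      using that[of "rat_X * rat_recip (to_fract (g k))"] beta_nonzero[of k] pole_nonzero[of k] assms
      unfolding e by (simp add: pole_order_def inverse_pole_def)
  qed
qed

text \<open>The reversal of h_k is 1 - \<sigma>_k \<lambda>, with value 1 at 0 whatever the node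
  is.\<close>

lemma unit_at_rat_X_recip_h: "unit_at 0 (rat_X * rat_recip (to_fract (h k)))"
proof -
  have "degree (h k) \<le> 1"
    by (simp add: newton_h_def)
  then show ?thesis
    by (simp add: rat_recip_to_fract rat_X_mult_poly_recip_linear) (simp add: newton_h_def)
qed

lemma rat_recip_rat_const: "rat_recip (rat_const c) = rat_const c"
  by (simp add: rat_const_def rat_recip_to_fract)

lemma sum_pole_order:
  assumes "\<forall>i\<in>{p+1..N-1}. \<xi> i \<noteq> None"
  shows "pole_order N + (\<Sum>k = 1..p. pole_order k) = num_infinite_poles \<xi> N"
proof -
  have "num_infinite_poles \<xi> N = (\<Sum>k = 1..N. pole_order k)"
    unfolding num_infinite_poles_def pole_order_def card_eq_sum by (rule sum.inter_filter) simp
  also have "\<dots> = (\<Sum>k \<in> insert N {1..p}. pole_order k)"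
    using assms pN by (intro sum.mono_neutral_right) (auto simp: pole_order_def)
  also have "\<dots> = pole_order N + (\<Sum>k = 1..p. pole_order k)"
    using pN by (intro sum.insert) auto
  finally show ?thesis ..
qed

text \<open>Zeros at 0 come from g_N in the numerator and from g_1, ..., g_p, which the division by
  b_p moves there. By \<open>sum_pole_order\<close> their total order is the number of infinite
  poles.\<close>

lemma rat_recip_factor:
  assumes "\<forall>i\<in>{p+1..N-1}. \<xi> i \<noteq> None"
  obtains u where "unit_at 0 u" "rat_X * rat_recip (factor p) = u * rat_X ^ num_infinite_poles \<xi> N"
proof -
  have "\<forall>k. \<exists>u. k \<in> {1..N} \<longrightarrow> unit_at 0 u \<and> rat_X * rat_recip (to_fract (g k)) = u * rat_X ^ pole_order k"
    using rat_X_recip_g by metis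
  then obtain u where u: "\<And>k. k \<in> {1..N} \<Longrightarrow> unit_at 0 (u k)"
    "\<And>k. k \<in> {1..N} \<Longrightarrow> rat_X * rat_recip (to_fract (g k)) = u k * rat_X ^ pole_order k"
    by metis
  let ?v = "\<lambda>k. rat_X * rat_recip (to_fract (h k))"
  \<comment> \<open>What is left of the reversed \<open>factor p\<close> once all powers of
    \<lambda> are pulled out; every piece is a unit at 0.\<close>
  let ?w = "rat_const (1 / \<beta> N) / rat_const (1 / \<beta> 0) * u N / (\<Prod>k = 1..p. ?v (k - 1) / u k)"
  have N: "N \<in> {1..N}" "{1..p} \<subseteq> {1..N}"
    using pN by auto
  have "unit_at 0 ?w"
    using u(1) N beta_nonzero[of 0] beta_nonzero[of N]
    by (intro unit_at_divide unit_at_mult[of _ "_ / _"] unit_at_prod unit_at_rat_X_recip_h) auto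
  moreover have "rat_recip (b p) = rat_const (1 / \<beta> 0) * (\<Prod>k = 1..p. ?v (k - 1) / u k / rat_X ^ pole_order k)"
  proof -
    have "rat_recip (to_fract (h (k - 1)) / to_fract (g k)) = ?v (k - 1) / u k / rat_X ^ pole_order k"
      if "k \<in> {1..p}" for k
    proof -
      \<comment> \<open>Numerator and denominator are multiplied by \<lambda>, so both become
        reversals of grade 1.\<close>
      have "rat_recip (to_fract (h (k - 1)) / to_fract (g k)) = ?v (k - 1) / (rat_X * rat_recip (to_fract (g k)))"
        by (simp add: rat_recip_divide)
      also have "\<dots> = ?v (k - 1) / u k / rat_X ^ pole_order k"
        using u(2)[of k] that N by auto
      finally show ?thesis .
    qed
    then show ?thesis
      unfolding newton_b_def by (simp add: rat_recip_mult rat_recip_prod rat_recip_rat_const)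
  qed
  then have "rat_recip (b p) = rat_const (1 / \<beta> 0) * (\<Prod>k = 1..p. ?v (k - 1) / u k) / rat_X ^ (\<Sum>k = 1..p. pole_order k)"
    by (simp add: prod_dividef power_sum)
  moreover have "rat_X * rat_recip (to_fract gN) = rat_const (1 / \<beta> N) * (u N * rat_X ^ pole_order N)"
    unfolding u(2)[OF N(1), symmetric]
    by (simp only: gN_def to_fract_smult rat_recip_mult rat_recip_rat_const mult_ac)
  ultimately have "rat_X * rat_recip (factor p) = ?w * rat_X ^ (pole_order N + (\<Sum>k = 1..p. pole_order k))"
    unfolding factor_def rat_recip_divide by (simp add: power_add)
  then show thesis
    using that \<open>unit_at 0 ?w\<close> unfolding sum_pole_order[OF assms] by blast
qed

text \<open>Linearization at infinity reverses L with its actual degree, so degree 0 must be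
  excluded. The entry g_(p+1) in block row p does this: its pole is finite and its block is nonempty
  by r >= 1. The entries -h_p U^T of the same row could all vanish.\<close>

lemma degree_mat_L:
  assumes "\<forall>i\<in>{p+1..N-1}. \<xi> i \<noteq> None" "r \<ge> 1"
  shows "degree_mat L = 1"
proof -
  have "0 < ht p" "0 < wd (Suc p)" "p < N - 1" "Suc p < N"
    using pN assms(2) by (auto simp: ht_def wd_def)
  note pos = this
  then have e: "K $$ (offset ht p + 0, offset wd (Suc p) + 0) = g (Suc p)"
    by (subst K_index) (simp_all del: offset_Suc)
  \<comment> \<open>The summands 0 keep the indices in the block form that
    \<open>offset_add_less\<close> expects.\<close>
  have lt: "offset ht p + 0 < rows_K" "offset wd (Suc p) + 0 < m + rows_K"
    unfolding rows_K_def offset_wd[unfolded rows_K_def, symmetric]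
    using pos by (blast intro: offset_add_less)+
  have "\<xi> (Suc p) \<noteq> None"
    using assms pN by auto
  then have "degree (g (Suc p)) = 1"
    using pole_nonzero[of "Suc p"] beta_nonzero[of "Suc p"] pN
    by (auto simp: newton_g_def inverse_pole_def)
  moreover have "g (Suc p) \<in> elements_mat L"
    using L_carrier lt e by (intro elements_matI[OF L_carrier, of "m + offset ht p" "offset wd (Suc p)"]) (auto simp: L_index simp del: offset_Suc)
  ultimately have "1 \<le> degree_mat L"
    unfolding degree_mat_def using finite_elements_mat[of L] by (intro Max_ge) (auto intro: rev_image_eqI)
  then show ?thesis
    using pencil_L by (simp add: pencil_def)
qed

text \<open>Reversing the identities for W, K and M with \<open>T p\<close> gives the same three
  identities at infinity, with the unit u in place of the scalar and the reversal of Q in place of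
  Q; the local factorization then applies at the point 0.\<close>

lemma linearization_infinity:
  assumes "\<forall>i\<in>{p+1..N-1}. \<xi> i \<noteq> None" "r \<ge> 1"
  shows "linearization_at_infinity L Q (int (num_infinite_poles \<xi> N))"
  unfolding linearization_at_infinity_def Let_def degree_mat_L[OF assms]
proof (intro conjI)
  let ?G = "rev_mat (int (num_infinite_poles \<xi> N)) Q"
  show "pencil L" "square_mat Q"
    using pencil_L Q_carrier by auto
  obtain u where u: "no_pole_at 0 u" "rat_eval 0 u \<noteq> 0"
    "rat_X * rat_recip (factor p) = u * rat_X ^ num_infinite_poles \<xi> N"
    using rat_recip_factor[OF assms(1)] unfolding unit_at_def by blast
  let ?M = "rev_mat 1 (rat_mat M)" and ?K = "rev_mat 1 (rat_mat K)" and ?T = "map_mat rat_recip (T p)"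
  have M: "?M \<in> carrier_mat m (m + rows_K)" and K: "?K \<in> carrier_mat rows_K (m + rows_K)"
    and T: "?T \<in> carrier_mat (m + rows_K) m" and G: "?G \<in> carrier_mat m m"
    using rat_carriers T_carrier Q_carrier by (auto simp: rev_mat_def)
  have revM: "?M = map_mat (\<lambda>a. to_fract [:coeff a 1, coeff a 0:]) M"
    by (rule rev_mat_rat_mat[OF M_carrier degree_M_index])
  have revK: "?K = map_mat (\<lambda>a. to_fract [:coeff a 1, coeff a 0:]) K"
    by (rule rev_mat_rat_mat[OF K_carrier degree_K_index])
  have np: "no_pole_mat_at 0 ?M" "no_pole_mat_at 0 ?K"
    unfolding revM revK by (auto simp: no_pole_mat_at_iff)
  \<comment> \<open>\<open>W p\<close> is constant, so the substitution leaves it unchanged and the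
    normalisation of \<open>T p\<close> carries over.\<close>
  have "W p = map_mat rat_recip (W p)"
    by (intro eq_matI) (auto simp: W_def)
  then have WT: "W p * ?T = 1\<^sub>m m"
    using rat_recip.mat_hom_mult[OF W_carrier T_carrier, of p p] W_T[of p]
    by (metis order_refl rat_recip.mat_hom_one)
  have KT: "?K * ?T = 0\<^sub>m rows_K m"
    unfolding rev_mat_mult[OF rat_carriers(2) T_carrier, symmetric] K_T
    by (intro eq_matI) (auto simp: rev_mat_def)
  have MT: "?M * ?T = u \<cdot>\<^sub>m ?G"
    unfolding rev_mat_mult[OF rat_carriers(1) T_carrier, symmetric] M_T
  proof (intro eq_matI)
    fix i j assume "i < dim_row (u \<cdot>\<^sub>m ?G)" "j < dim_col (u \<cdot>\<^sub>m ?G)"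
    then have ij: "i < m" "j < m"
      using Q_carrier by (auto simp: rev_mat_def)
    have "rev_mat 1 (factor p \<cdot>\<^sub>m Q) $$ (i, j) = (rat_X * rat_recip (factor p)) * rat_recip (Q $$ (i, j))"
      using ij Q_carrier by (auto simp: rev_mat_def rat_recip_mult)
    then show "rev_mat 1 (factor p \<cdot>\<^sub>m Q) $$ (i, j) = (u \<cdot>\<^sub>m ?G) $$ (i, j)"
      unfolding u(3) using ij Q_carrier by (simp add: rev_mat_def)
  qed (use Q_carrier in \<open>auto simp: rev_mat_def\<close>)
  \<comment> \<open>At 0 a reversed entry takes the value of its coefficient of \<lambda>.\<close>
  have "map_mat (rat_eval 0) (W p @\<^sub>r ?K) = W p @\<^sub>r map_mat (\<lambda>a. coeff a 1) K"
    unfolding map_mat_append_rows[OF W_carrier K] rat_eval_W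
    unfolding revK by (intro arg_cong2[of _ _ _ _ append_rows] eq_matI) auto
  moreover have "coeff (g (Suc i)) 1 \<noteq> 0" if "p \<le> i" "i < N - 1" for i
  proof -
    have "\<xi> (Suc i) \<noteq> None" "Suc i \<in> {1..N}"
      using assms that by auto
    then show ?thesis
      using pole_nonzero[of "Suc i"] beta_nonzero[of "Suc i"] by (auto simp: newton_g_def inverse_pole_def)
  qed
  \<comment> \<open>All h_i have leading coefficient 1, so leftward elimination is free; rightward
    it uses the finite poles \<xi>_(p+1), ..., \<xi>_(N-1).\<close>
  then have "det (W p @\<^sub>r map_mat (\<lambda>a. coeff a 1) K) \<noteq> 0"
    by (intro det_W_K_nonzero) (auto simp: newton_h_def)
  ultimately have d: "det (map_mat (rat_eval 0) (W p @\<^sub>r ?K)) \<noteq> 0"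
    by simp
  obtain R\<^sub>1 R\<^sub>2 where R: "R\<^sub>1 \<in> carrier_mat (m + rows_K) (m + rows_K)" "R\<^sub>2 \<in> carrier_mat (m + rows_K) (m + rows_K)"
    "regular_at 0 R\<^sub>1" "regular_at 0 R\<^sub>2"
    "R\<^sub>1 * diag_block_mat [?G, 1\<^sub>m rows_K] * R\<^sub>2 = ?M @\<^sub>r ?K"
    using local_linearization[OF M K W_carrier T G WT KT MT np no_pole_W d u(1,2)] by blast
  have "rev_mat 1 (rat_mat L) = ?M @\<^sub>r ?K"
    unfolding rat_mat_L rev_mat_def by (rule map_mat_append_rows[OF rat_carriers])
  then show "\<exists>s\<^sub>1 s\<^sub>2 Q\<^sub>1 Q\<^sub>2. int s\<^sub>1 - int s\<^sub>2 = int (dim_row L) - int (dim_row Q) \<and>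
      int s\<^sub>1 - int s\<^sub>2 = int (dim_col L) - int (dim_row Q) \<and>
      Q\<^sub>1 \<in> carrier_mat (dim_row Q + s\<^sub>1) (dim_row Q + s\<^sub>1) \<and>
      Q\<^sub>2 \<in> carrier_mat (dim_row Q + s\<^sub>1) (dim_row Q + s\<^sub>1) \<and>
      regular_at 0 Q\<^sub>1 \<and> regular_at 0 Q\<^sub>2 \<and>
      Q\<^sub>1 * diag_block_mat [?G, 1\<^sub>m s\<^sub>1] * Q\<^sub>2 = diag_block_mat [rev_mat (int 1) (rat_mat L), 1\<^sub>m s\<^sub>2]"
    unfolding dims
    by (intro exI[of _ rows_K] exI[of _ 0] exI[of _ R\<^sub>1] exI[of _ R\<^sub>2] conjI R(1-4))
      (simp_all only: diag_block_mat_one_0 R(5) of_nat_1 of_nat_add of_nat_0 add_diff_cancel_left' diff_zero)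
qed

end

theorem theorem6p3:
  fixes m r p N :: nat
    and \<sigma> \<beta> :: "nat \<Rightarrow> 'a :: alg_closed_field"
    and \<xi> :: "nat \<Rightarrow> 'a option"
    and D E :: "nat \<Rightarrow> 'a mat" and U :: "'a mat"
    and Q :: "'a poly fract mat" and L M K :: "'a poly mat"
  assumes "m \<ge> 1" and "r \<ge> 1" and "p + 2 \<le> N"
    and "\<And>i. i \<in> {1..N} \<Longrightarrow> \<xi> i \<noteq> Some 0"
    and "\<And>i. i \<in> {0..N} \<Longrightarrow> \<beta> i \<noteq> 0"
    and "\<And>i. i \<in> {0..p} \<Longrightarrow> D i \<in> carrier_mat m m"
    and "\<And>i. i \<in> {p+1..N} \<Longrightarrow> E i \<in> carrier_mat m r"
    and "U \<in> carrier_mat m r"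
    and "Q = newton_Q \<beta> \<xi> \<sigma> m p N D E U"
    and "M = newton_M \<beta> \<xi> \<sigma> m p N D E"
    and "K = newton_K \<beta> \<xi> \<sigma> m r p N U"
    and "L = newton_L \<beta> \<xi> \<sigma> m r p N D E U"
  shows "(block_full_rank_pencil L M K \<and> associated_in M K Q (UNIV - finite_poles \<xi> N)) \<and>
         linearization_in L Q (UNIV - finite_poles \<xi> N) \<and>
         ((\<forall>i\<in>{p+1..N-1}. \<xi> i \<noteq> None) \<longrightarrow>
            linearization_at_infinity L Q (int (num_infinite_poles \<xi> N)))"
proof -
  interpret newton_pencil m r p N \<sigma> \<beta> \<xi> D E U
    using assms by unfold_locales
  show ?thesis
    unfolding assms(9-12)
    using block_full_rank associated linearization_finite linearization_infinity[OF _ assms(2)] by blast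
qed

end
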